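(* Let $\alpha$ be a real number such that $\alpha+2$ is neither zero nor a negative integer. Let $\varphi(z)=\dfrac{az+b}{cz+d}$ be a linear fractional self-map of the unit disk $\mathbb{D}$, and let $\sigma(z)=\dfrac{\bar a z-\bar c}{-\bar b z+\bar d}$ be its Kreĭn adjoint. Let $g(z)=(-\bar b z+\bar d)^{-\alpha-2}$ and $h(z)=(cz+d)^{\alpha+2}$ for $z\in\mathbb{D}$, where the holomorphic branches of the powers are chosen compatibly, i.e. so that $g(0)\overline{h(0)}=1$. Then the operator $C_\varphi^{*}-M_gC_\sigma M_h^{*}$ has finite rank on $A^2_\alpha$. Moreover, if $\alpha+2>0$, then $C_\varphi^{*}=M_gC_\sigma M_h^{*}$ on $A^2_\alpha$.
   Context: $\mathbb{D}$ is the open unit disk in $\mathbb{C}$. A linear fractional self-map of $\mathbb{D}$ is a map $\varphi(z)=(az+b)/(cz+d)$ with $a,b,c,d\in\mathbb{C}$, $ad-bc\neq 0$ and $\varphi(\mathbb{D})\subset\mathbb{D}$; its Kreĭn adjoint $\sigma$ is then also a self-map of $\mathbb{D}$, and $cz+d$ and $-\bar bz+\bar d$ do not vanish on the closed unit disk. For an analytic $\psi:\mathbb{D}\to\mathbb{D}$, $C_\psi f=f\circ\psi$ is the composition operator; $M_u f=uf$ is the multiplication operator with symbol $u$. Adjoints are taken in $A^2_\alpha$; all the operators $C_\varphi, C_\sigma, M_g, M_h$ are bounded on $A^2_\alpha$. For $\alpha\in\mathbb{R}$, $A^2_\alpha$ is the space of holomorphic functions $f$ on $\mathbb{D}$ for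 which there is an integer $k\ge 0$ with $\alpha+2k>-1$ such that $(1-|z|^2)^kf^{(k)}(z)\in L^2(\mathbb{D},dA_\alpha)$, where $dA_\alpha(z)=(1-|z|^2)^\alpha dA(z)$ and $dA$ is area measure. It is a reproducing kernel Hilbert space under the inner product whose reproducing kernel (when $\alpha+2$ is not zero or a negative integer) is as follows: - if $\alpha+2>0$: $K_\alpha(z,w)=(1-z\bar w)^{-(\alpha+2)}$; - if $-N<\alpha+2<-N+1$ for a positive integer $N$: $K_\alpha(z,w)=(-1)^N(1-z\bar w)^{-(\alpha+2)}+Q(z\bar w)$, where $Q$ is a fixed analytic polynomial of degree $N$ (such that all Taylor coefficients of $K_\alpha$ in $z\bar w$ are positive). Powers of $1-z\bar w$ use the principal branch. The monomials $z^m$, $m\ge0$, form an orthogonal basis of $A^2_\alpha$, and $\|z^m\|_\alpha^{-2}$ is the coefficient of $(z\bar w)^m$ in $K_\alpha$. *)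

theory Defs
  imports "HOL-Complex_Analysis.Complex_Analysis"
begin

abbreviation unit_disk :: "complex set" where
  "unit_disk \<equiv> ball 0 1"

text \<open>
  Functions on the disk are represented by functions on the whole plane that vanish off the disk,
  so that equality of functions is equality on the disk. Square integrability is taken with
  respect to the weighted area measure with density \<open>(1 - |z|\<^sup>2) powr \<alpha>\<close>.
\<close>

definition A2 :: "real \<Rightarrow> (complex \<Rightarrow> complex) set" where
  "A2 \<alpha> = {f. f holomorphic_on unit_disk \<and> (\<forall>z. z \<notin> unit_disk \<longrightarrow> f z = 0) \<and>
     (\<exists>k::nat. \<alpha> + 2 * real k > -1 \<and>
        set_integrable lborel unit_disk
          (\<lambda>z. (cmod ((1 - (cmod z)\<^sup>2) ^ k * (deriv ^^ k) f z))\<^sup>2 * (1 - (cmod z)\<^sup>2) powr \<alpha>))}"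

definition taylor_coeff :: "(complex \<Rightarrow> complex) \<Rightarrow> nat \<Rightarrow> complex" where
  "taylor_coeff f m = (deriv ^^ m) f 0 / fact m"

text \<open>
  The reproducing kernel is \<open>K(z, w) = kernel_profile \<alpha> N Q (z * cnj w)\<close>. The power is the
  principal one. The data \<open>N\<close> and \<open>Q\<close> are \<open>0\<close> if \<open>\<alpha> + 2 > 0\<close>; otherwise
  \<open>-N < \<alpha> + 2 < -N + 1\<close> and \<open>Q\<close> is any polynomial of degree \<open>N\<close>
  making all Taylor coefficients positive.
\<close>

definition kernel_profile :: "real \<Rightarrow> nat \<Rightarrow> complex poly \<Rightarrow> complex \<Rightarrow> complex" where
  "kernel_profile \<alpha> N Q x = (-1) ^ N * (1 - x) powr (- (complex_of_real \<alpha> + 2)) + poly Q x"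

definition kernel_data :: "real \<Rightarrow> nat \<Rightarrow> complex poly \<Rightarrow> bool" where
  "kernel_data \<alpha> N Q \<longleftrightarrow>
     (\<alpha> + 2 > 0 \<and> N = 0 \<and> Q = 0) \<or>
     (N > 0 \<and> - real N < \<alpha> + 2 \<and> \<alpha> + 2 < - real N + 1 \<and> degree Q = N \<and>
      (\<forall>m. \<exists>r>0. taylor_coeff (kernel_profile \<alpha> N Q) m = complex_of_real r))"

text \<open>
  The inner product with this reproducing kernel: monomials are orthogonal, and the squared norm
  of \<open>z ^ m\<close> is the inverse of the coefficient of \<open>(z * cnj w) ^ m\<close> in the kernel.
\<close>

definition A2_inner ::
  "real \<Rightarrow> nat \<Rightarrow> complex poly \<Rightarrow> (complex \<Rightarrow> complex) \<Rightarrow> (complex \<Rightarrow> complex) \<Rightarrow> complex" where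
  "A2_inner \<alpha> N Q f g =
     (\<Sum>m. taylor_coeff f m * cnj (taylor_coeff g m) / taylor_coeff (kernel_profile \<alpha> N Q) m)"

definition A2_adjoint ::
  "real \<Rightarrow> nat \<Rightarrow> complex poly \<Rightarrow> ((complex \<Rightarrow> complex) \<Rightarrow> (complex \<Rightarrow> complex)) \<Rightarrow>
     (complex \<Rightarrow> complex) \<Rightarrow> (complex \<Rightarrow> complex)" where
  "A2_adjoint \<alpha> N Q T f =
     (THE g. g \<in> A2 \<alpha> \<and> (\<forall>u\<in>A2 \<alpha>. A2_inner \<alpha> N Q (T u) f = A2_inner \<alpha> N Q u g))"

definition comp_op :: "(complex \<Rightarrow> complex) \<Rightarrow> (complex \<Rightarrow> complex) \<Rightarrow> (complex \<Rightarrow> complex)" where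
  "comp_op \<psi> f = (\<lambda>z. if z \<in> unit_disk then f (\<psi> z) else 0)"

definition mult_op :: "(complex \<Rightarrow> complex) \<Rightarrow> (complex \<Rightarrow> complex) \<Rightarrow> (complex \<Rightarrow> complex)" where
  "mult_op u f = (\<lambda>z. u z * f z)"

definition finite_rank_on ::
  "(complex \<Rightarrow> complex) set \<Rightarrow> ((complex \<Rightarrow> complex) \<Rightarrow> (complex \<Rightarrow> complex)) \<Rightarrow> bool" where
  "finite_rank_on H T \<longleftrightarrow>
     (\<exists>B. finite B \<and> B \<subseteq> H \<and> (\<forall>f\<in>H. \<exists>coef. T f = (\<lambda>z. \<Sum>e\<in>B. coef e * e z)))"

definition lin_frac :: "complex \<Rightarrow> complex \<Rightarrow> complex \<Rightarrow> complex \<Rightarrow> complex \<Rightarrow> complex" where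
  "lin_frac a b c d z = (a * z + b) / (c * z + d)"

definition krein_adjoint :: "complex \<Rightarrow> complex \<Rightarrow> complex \<Rightarrow> complex \<Rightarrow> complex \<Rightarrow> complex" where
  "krein_adjoint a b c d z = (cnj a * z - cnj c) / (- cnj b * z + cnj d)"

text \<open>\<open>g\<close> is a holomorphic branch of \<open>p ^ s\<close> on the disk, i.e. it comes from a holomorphic
  branch \<open>L\<close> of \<open>log p\<close>.\<close>

definition power_branch :: "(complex \<Rightarrow> complex) \<Rightarrow> real \<Rightarrow> (complex \<Rightarrow> complex) \<Rightarrow> bool" where
  "power_branch p s g \<longleftrightarrow>
     (\<exists>L. L holomorphic_on unit_disk \<and>
        (\<forall>z\<in>unit_disk. exp (L z) = p z \<and> g z = exp (complex_of_real s * L z)))"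

end

theory Submission
  imports Defs "HOL-Real_Asymp.Real_Asymp"
begin

text \<open>
  Evaluating an adjoint at \<open>w\<close> means pairing with the reproducing kernel \<open>K\<^sub>w\<close>: one has
  \<open>(T\<^sup>* f)(w) = \<langle>f, T K\<^sub>w\<rangle>\<close>. So the difference of the two operators, applied to \<open>f\<close> and evaluated
  at \<open>w\<close>, is the pairing of \<open>f\<close> with \<open>K\<^sub>w \<circ> \<phi> - cnj (g w) h K\<^bsub>\<sigma>(w)\<^esub>\<close>. The Krein identity
  \<open>(1 - \<phi>(z) cnj w) (c z + d) = cnj (- cnj b w + cnj d) (1 - z cnj (\<sigma> w))\<close>, raised to the power
  \<open>- \<alpha> - 2\<close>, cancels the singular parts of the kernels. Only the polynomial \<open>Q\<close> contributes, and it
  gives a combination of the functions \<open>w\<^sup>j\<close> and \<open>g(w) \<sigma>(w)\<^sup>j\<close> with \<open>j \<le> degree Q\<close>.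

  The adjoints exist because \<open>f \<mapsto> h (f \<circ> \<phi>)\<close> is bounded. By Parseval's identity, membership in \<open>A2\<close>
  says that \<open>\<Sum> |f\<^sub>m|\<^sup>2 (m + 1) powr (- (\<alpha> + 1))\<close> is finite, and in this form differentiation trades \<open>\<alpha>\<close>
  for \<open>\<alpha> + 2\<close>.
\<close>

section \<open>Change of variables for holomorphic maps\<close>

text \<open>\<open>A2_adjoint\<close> is a \<open>THE\<close>, so boundedness has to come first: it
  is what makes the representing function exist. Substitution in an area integral gives the bound
  for \<alpha> \<ge> 0 only. Below that, (1 - |z|^2)^\<alpha> is no longer controlled by (1 -
  |\<phi>(z)|^2)^\<alpha> through monotonicity, and from \<alpha> \<le> -1 on membership in
  \<open>A2\<close> is a condition on a derivative. Differentiating h (f o \<phi>) creates weighted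
  compositions with the multipliers h' and h \<phi>'. So even the bound for composition alone forces
  multipliers into the induction, and they are kept holomorphic past the closed disk to remain
  bounded after further derivatives. Raising the Krein identity to a real power is a question of
  branches. Divided by d, its four factors all have positive real part, where principal logarithms
  add, and g(0) conj(h(0)) = 1 cancels the constant factors of g and h.\<close>

lemma nn_integral_eq_iff_has_integral:
  fixes u :: "'a::euclidean_space \<Rightarrow> real"
  assumes "(\<lambda>x. indicator S x * u x) \<in> borel_measurable borel" "\<And>x. x \<in> S \<Longrightarrow> 0 \<le> u x" "0 \<le> b"
  shows "(\<integral>\<^sup>+x. ennreal (indicator S x * u x) \<partial>lborel) = ennreal b \<longleftrightarrow> (u has_integral b) S"
proof -
  have eq: "(\<lambda>x. if x \<in> S then u x else 0) = (\<lambda>x. indicator S x * u x)"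
    by (auto simp: indicator_def)
  have "(u has_integral b) S \<longleftrightarrow> ((\<lambda>x. indicator S x * u x) has_integral b) UNIV"
    using has_integral_restrict_UNIV[of S u b] unfolding eq by simp
  moreover have "0 \<le> indicator S x * u x" for x
    using assms(2) by (simp add: indicator_def)
  ultimately show ?thesis
    using nn_integral_has_integral[OF assms(1), of b] nn_integral_has_integral_lborel[OF assms(1), of b]
      assms(3) by blast
qed

text \<open>The theorem for absolutely integrable functions shows that one side has the finite value
  b exactly when the other does. Hence neither side can be infinite alone, and the formula holds in
  \<open>ennreal\<close> without integrability assumptions.\<close>

lemma nn_integral_change_of_variables:
  fixes g :: "real^'m::{finite,wellorder} \<Rightarrow> real^'m::_" and h :: "real^'m::_ \<Rightarrow> real"
  assumes S: "S \<in> sets borel"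
    and der: "\<And>x. x \<in> S \<Longrightarrow> (g has_derivative g' x) (at x within S)"
    and inj: "inj_on g S"
    and m1: "(\<lambda>x. indicator S x * (\<bar>det (matrix (g' x))\<bar> * h (g x))) \<in> borel_measurable borel"
    and m2: "(\<lambda>x. indicator (g ` S) x * h x) \<in> borel_measurable borel"
    and nonneg: "\<And>x. 0 \<le> h x"
  shows "(\<integral>\<^sup>+x. ennreal (indicator S x * (\<bar>det (matrix (g' x))\<bar> * h (g x))) \<partial>lborel)
       = (\<integral>\<^sup>+x. ennreal (indicator (g ` S) x * h x) \<partial>lborel)" (is "?l = ?r")
proof -
  have iff: "?l = ennreal b \<longleftrightarrow> ?r = ennreal b" if "0 \<le> b" for b
  proof -
    have "?l = ennreal b \<longleftrightarrow> ((\<lambda>x. \<bar>det (matrix (g' x))\<bar> * h (g x)) has_integral b) S"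
      using nn_integral_eq_iff_has_integral[OF m1 _ that] nonneg by simp
    also have "\<dots> \<longleftrightarrow> (h has_integral b) (g ` S)"
    proof -
      have Sl: "S \<in> sets lebesgue" using S by simp
      \<comment> \<open>The integrand of this theorem is vector valued, so the real function passes
        through \<open>real^1\<close>.\<close>
      note * = has_absolute_integral_change_of_variables[OF Sl der inj,
          where f = "\<lambda>x. vec (h x) :: real^1" and b = "vec b"]
      have nn: "\<And>x. 0 \<le> \<bar>det (matrix (g' x))\<bar> * h (g x)" using nonneg by simp
      have 1: "(\<lambda>x. \<bar>det (matrix (g' x))\<bar> *\<^sub>R (vec (h (g x)) :: real^1)) =
            (\<lambda>x. vec (\<bar>det (matrix (g' x))\<bar> * h (g x)))"
        by (auto simp: vec_eq_iff)
      have "(h has_integral b) (g ` S) \<longleftrightarrow> (\<lambda>x. vec (h x) :: real^1) absolutely_integrable_on g ` S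
          \<and> integral (g ` S) (\<lambda>x. vec (h x) :: real^1) = vec b"
        unfolding absolutely_integrable_on_1_iff integral_on_1_eq
        using nonneg by (auto simp: has_integral_iff absolutely_integrable_on_iff_nonneg vec_eq_iff)
      moreover have "((\<lambda>x. \<bar>det (matrix (g' x))\<bar> * h (g x)) has_integral b) S \<longleftrightarrow>
           (\<lambda>x. vec (\<bar>det (matrix (g' x))\<bar> * h (g x)) :: real^1) absolutely_integrable_on S
          \<and> integral S (\<lambda>x. vec (\<bar>det (matrix (g' x))\<bar> * h (g x)) :: real^1) = vec b"
        unfolding absolutely_integrable_on_1_iff integral_on_1_eq
        using nn by (auto simp: has_integral_iff absolutely_integrable_on_iff_nonneg vec_eq_iff)
      ultimately show ?thesis using * unfolding 1 by simp
    qed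
    also have "\<dots> \<longleftrightarrow> ?r = ennreal b"
      using nn_integral_eq_iff_has_integral[OF m2 _ that] nonneg by simp
    finally show ?thesis .
  qed
  show ?thesis
  proof (cases ?l)
    case (real r)
    then show ?thesis using iff[of r] by simp
  next
    case top
    then show ?thesis using iff by (cases ?r) auto
  qed
qed

lemma borel_measurable_Complex_vec [measurable]:
  "(\<lambda>v::real^2. Complex (v$1) (v$2)) \<in> borel_measurable borel"
proof -
  have eq: "(\<lambda>v::real^2. Complex (v$1) (v$2)) = (\<lambda>v. of_real (v$1) + \<i> * of_real (v$2))"
    by (auto simp: complex_eq_iff)
  show ?thesis
    unfolding eq by (intro borel_measurable_continuous_onI continuous_intros)
qed

text \<open>Boxes correspond to boxes with the same sides, and boxes determine Lebesgue measure.
  This carries the determinant formula from \<open>real^2\<close> over to the complex plane.\<close>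

lemma distr_lborel_Complex:
  "distr lborel borel (\<lambda>v::real^2. Complex (v$1) (v$2)) = lborel"
proof (rule lborel_eqI[symmetric])
  show "sets (distr lborel borel (\<lambda>v::real^2. Complex (v$1) (v$2))) = sets borel" by simp
  fix l u :: complex
  assume le: "\<And>b. b \<in> Basis \<Longrightarrow> l \<bullet> b \<le> u \<bullet> b"
  have le': "Re l \<le> Re u" "Im l \<le> Im u" using le[of 1] le[of \<i>] by (auto simp: Basis_complex_def)
  have vi: "(\<lambda>v::real^2. Complex (v$1) (v$2)) -` box l u = box (vector [Re l, Im l]) (vector [Re u, Im u])"
    by (rule set_eqI, unfold vimage_eq mem_box_cart forall_2) (auto simp: in_box_complex_iff)
  have B2: "(Basis :: (real^2) set) = {axis 1 1, axis 2 1}"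
    by (simp add: Basis_vec_def UNIV_2 insert_commute)
  have ne: "axis 1 (1::real) \<noteq> (axis 2 1 :: real^2)" by (simp add: axis_eq_axis)
  have "emeasure (distr lborel borel (\<lambda>v::real^2. Complex (v$1) (v$2))) (box l u)
      = emeasure lborel (box (vector [Re l, Im l] :: real^2) (vector [Re u, Im u]))"
    by (subst emeasure_distr) (auto simp: vi)
  also have "\<dots> = ennreal ((Re u - Re l) * (Im u - Im l))"
    using le' by (subst emeasure_lborel_box) (auto simp: B2 ne inner_axis)
  also have "(Re u - Re l) * (Im u - Im l) = (\<Prod>b\<in>Basis. (u - l) \<bullet> b)"
    by (simp add: Basis_complex_def)
  finally show "emeasure (distr lborel borel (\<lambda>v::real^2. Complex (v$1) (v$2))) (box l u)
     = ennreal (\<Prod>b\<in>Basis. (u - l) \<bullet> b)" .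
qed

lemma nn_integral_complex_eq_vec:
  assumes [measurable]: "F \<in> borel_measurable borel"
  shows "(\<integral>\<^sup>+z. F z \<partial>(lborel :: complex measure)) = (\<integral>\<^sup>+v. F (Complex (v$1) (v$2)) \<partial>(lborel :: (real^2) measure))"
  by (subst distr_lborel_Complex[symmetric], subst nn_integral_distr) auto

text \<open>The derivative of a holomorphic map is multiplication by \<open>deriv g z\<close>, and
  as a real 2 by 2 matrix this has determinant |\<open>deriv g z\<close>|^2. The maps
  \<open>J\<close> and \<open>I\<close> translate between the plane and
  \<open>real^2\<close>.\<close>

lemma nn_integral_holomorphic_change_of_variables:
  fixes F :: "complex \<Rightarrow> real"
  assumes S: "open S" and hol: "g holomorphic_on S" and inj: "inj_on g S"
    and F [measurable]: "F \<in> borel_measurable borel" and nonneg: "\<And>z. 0 \<le> F z"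
  shows "(\<integral>\<^sup>+z. ennreal (indicator S z * ((cmod (deriv g z))\<^sup>2 * F (g z))) \<partial>lborel)
       = (\<integral>\<^sup>+z. ennreal (indicator (g ` S) z * F z) \<partial>lborel)"
proof -
  define J :: "complex \<Rightarrow> real^2" where "J = (\<lambda>z. vector [Re z, Im z])"
  define I :: "real^2 \<Rightarrow> complex" where "I = (\<lambda>v. Complex (v$1) (v$2))"
  have IJ [simp]: "I (J z) = z" and JI [simp]: "J (I v) = v" for z v
    by (auto simp: I_def J_def vec_eq_iff forall_2)
  have linJ: "bounded_linear J"
    by (rule linear_conv_bounded_linear[THEN iffD1], rule linearI) (auto simp: J_def vec_eq_iff forall_2)
  have linI: "bounded_linear I"
    by (rule linear_conv_bounded_linear[THEN iffD1], rule linearI) (auto simp: I_def complex_eq_iff)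
  have [measurable]: "I \<in> borel_measurable borel" unfolding I_def by measurable
  have [measurable]: "S \<in> sets borel" using S by simp
  have oS: "open (g ` S)" using open_mapping_thm3[OF hol S inj] .
  then have [measurable]: "g ` S \<in> sets borel" by simp
  have cg: "continuous_on S g" using hol by (rule holomorphic_on_imp_continuous_on)
  have cg': "continuous_on S (deriv g)"
    using holomorphic_on_imp_continuous_on[OF holomorphic_deriv[OF hol S]] .
  define T where "T = I -` S"
  define G where "G = (\<lambda>v. J (g (I v)))"
  define G' where "G' = (\<lambda>v x. J (deriv g (I v) * I x))"
  have oT: "open T" unfolding T_def
    using open_vimage[OF S] linear_continuous_on[OF linI] by blast
  have injG: "inj_on G T" using inj by (auto simp: inj_on_def G_def T_def) (metis IJ JI)
  have GT: "G ` T = I -` (g ` S)"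
    by (auto simp: G_def T_def) (metis IJ JI image_eqI vimageI)
  have derG: "(G has_derivative G' v) (at v within T)" if "v \<in> T" for v
  proof -
    have "(g has_field_derivative deriv g (I v)) (at (I v))"
      using that hol S T_def holomorphic_derivI by fastforce
    then have d: "(g has_derivative (*) (deriv g (I v))) (at (I v))"
      by (simp add: has_field_derivative_def)
    have "(g \<circ> I has_derivative (*) (deriv g (I v)) \<circ> I) (at v)"
      by (rule diff_chain_at[OF bounded_linear_imp_has_derivative[OF linI] d])
    then have "(J \<circ> (g \<circ> I) has_derivative J \<circ> ((*) (deriv g (I v)) \<circ> I)) (at v)"
      by (rule diff_chain_at[OF _ bounded_linear_imp_has_derivative[OF linJ]])
    then show ?thesis
      unfolding G_def G'_def by (auto simp: o_def intro: has_derivative_at_withinI)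
  qed
  have det: "\<bar>det (matrix (G' v))\<bar> = (cmod (deriv g (I v)))\<^sup>2" for v
  proof -
    have "det (matrix (G' v)) = (cmod (deriv g (I v)))\<^sup>2"
      unfolding det_2 cmod_power2
      by (simp add: matrix_def G'_def J_def I_def axis_def power2_eq_square)
    then show ?thesis by simp
  qed
  have m: "(\<lambda>z. indicator S z * ((cmod (deriv g z))\<^sup>2 * F (g z))) \<in> borel_measurable borel"
  proof -
    have [measurable]: "(\<lambda>z. indicator S z *\<^sub>R deriv g z) \<in> borel_measurable borel"
       "(\<lambda>z. indicator S z *\<^sub>R g z) \<in> borel_measurable borel"
      using borel_measurable_continuous_on_indicator[OF _ cg']
        borel_measurable_continuous_on_indicator[OF _ cg] by auto
    \<comment> \<open>Continuity of \<open>g\<close> and \<open>deriv g\<close> is known on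
      \<open>S\<close> only, so both are cut off before measurability is checked. The outer
      indicator makes the cut-off invisible.\<close>
    have "(\<lambda>z. indicator S z * ((cmod (indicator S z *\<^sub>R deriv g z))\<^sup>2 * F (indicator S z *\<^sub>R g z)))
         \<in> borel_measurable borel" by measurable
    also have "(\<lambda>z. indicator S z * ((cmod (indicator S z *\<^sub>R deriv g z))\<^sup>2 * F (indicator S z *\<^sub>R g z))) =
       (\<lambda>z. indicator S z * ((cmod (deriv g z))\<^sup>2 * F (g z)))"
      by (auto simp: indicator_def)
    finally show ?thesis .
  qed
  have "(\<integral>\<^sup>+z. ennreal (indicator S z * ((cmod (deriv g z))\<^sup>2 * F (g z))) \<partial>lborel)
      = (\<integral>\<^sup>+v. ennreal (indicator T v * (\<bar>det (matrix (G' v))\<bar> * F (I (G v)))) \<partial>lborel)"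
    using m by (subst nn_integral_complex_eq_vec)
      (auto simp: det G_def T_def indicator_def, simp add: I_def)
  also have "\<dots> = (\<integral>\<^sup>+v. ennreal (indicator (G ` T) v * F (I v)) \<partial>lborel)"
  proof (rule nn_integral_change_of_variables[where h = "\<lambda>v. F (I v)"])
    show "T \<in> sets borel" using oT by simp
    show "(\<lambda>x. indicator (G ` T) x * F (I x)) \<in> borel_measurable borel"
      unfolding GT by measurable
    have "(\<lambda>x. (\<lambda>z. indicator S z * ((cmod (deriv g z))\<^sup>2 * F (g z))) (I x)) \<in> borel_measurable borel"
      using m by measurable
    then show "(\<lambda>x. indicator T x * (\<bar>det (matrix (G' x))\<bar> * F (I (G x)))) \<in> borel_measurable borel"
      by (simp add: det G_def T_def indicator_def)
  qed (use derG injG nonneg in auto)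
  also have "\<dots> = (\<integral>\<^sup>+z. ennreal (indicator (g ` S) z * F z) \<partial>lborel)"
    by (subst nn_integral_complex_eq_vec) (auto simp: GT indicator_def I_def)
  finally show ?thesis .
qed

lemma nn_integral_rotation:
  fixes F :: "complex \<Rightarrow> real"
  assumes [measurable]: "F \<in> borel_measurable borel" and "\<And>z. 0 \<le> F z" and u: "cmod u = 1"
  shows "(\<integral>\<^sup>+z. ennreal (F (u * z)) \<partial>lborel) = (\<integral>\<^sup>+z. ennreal (F z) \<partial>lborel)"
proof -
  have u0: "u \<noteq> 0" using u by auto
  have d: "deriv ((*) u) z = u" for z
    by (rule DERIV_imp_deriv) (auto intro!: derivative_eq_intros)
  have "range ((*) u) = UNIV" using u0
    by (metis UNIV_I equalityI mult.commute nonzero_divide_eq_eq rangeI subsetI)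
  then show ?thesis
    using nn_integral_holomorphic_change_of_variables[of UNIV "(*) u" F] assms u0
    by (auto simp: d inj_on_def intro!: holomorphic_intros)
qed

section \<open>Weighted area integrals and Taylor coefficients\<close>

lemma unit_disk_borel [measurable]: "unit_disk \<in> sets borel"
  by simp

text \<open>The annulus x < |z|^2 < 1 has area pi (1 - x), so |z|^2 is uniformly distributed on
  [0,1] with total mass pi. This is polar integration in the variable t = |z|^2.\<close>

lemma distr_disk_norm_square:
  "distr (density lborel (indicator unit_disk)) borel (\<lambda>z::complex. (cmod z)\<^sup>2)
     = density lborel (\<lambda>t. ennreal pi * indicator {0..1::real} t)" (is "?M = ?N")
proof (rule measure_eqI_lessThan)
  have M: "emeasure ?M {x<..} = emeasure lborel {z. cmod z < 1 \<and> x < (cmod z)\<^sup>2}" for x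
  proof -
    have [measurable]: "{z::complex. x < (cmod z)\<^sup>2} \<in> sets borel" by measurable
    have "emeasure ?M {x<..} = (\<integral>\<^sup>+z. indicator unit_disk z * indicator {z. x < (cmod z)\<^sup>2} z \<partial>lborel)"
      by (simp add: emeasure_distr vimage_def, subst emeasure_density) measurable
    also have "\<dots> = (\<integral>\<^sup>+z. indicator {z. cmod z < 1 \<and> x < (cmod z)\<^sup>2} z \<partial>lborel)"
      by (intro nn_integral_cong) (auto simp: indicator_def)
    finally show ?thesis by simp
  qed
  have N: "emeasure ?N {x<..} = ennreal pi * emeasure lborel ({0..1} \<inter> {x<..})" for x
  proof -
    have "emeasure ?N {x<..} = (\<integral>\<^sup>+t. ennreal pi * indicator ({0..1} \<inter> {x<..}) t \<partial>lborel)"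
      by (subst emeasure_density) (auto intro!: nn_integral_cong simp: indicator_def)
    then show ?thesis by (simp add: nn_integral_cmult)
  qed
  have ball: "emeasure lborel (ball (0::complex) 1) = ennreal pi"
    by (simp add: emeasure_ball unit_ball_vol_numeral)
  show eq: "emeasure ?M {x<..} = emeasure ?N {x<..}" for x
  proof -
    consider "x < 0" | "0 \<le> x" "x < 1" | "1 \<le> x" by linarith
    then show ?thesis
    proof cases
      case 1
      then have "{z. cmod z < 1 \<and> x < (cmod z)\<^sup>2} = ball 0 1"
        by (auto intro: less_le_trans[OF _ zero_le_power2])
      moreover have "{0..1} \<inter> {x<..} = {0..1}" using 1 by auto
      ultimately show ?thesis unfolding M N by (simp add: ball)
    next
      case 2
      have sq: "x < y\<^sup>2 \<longleftrightarrow> sqrt x < y" if "y \<ge> 0" for y :: real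
        using that 2 by (metis real_less_rsqrt real_sqrt_less_iff real_sqrt_abs abs_of_nonneg)
      have "{z. cmod z < 1 \<and> x < (cmod z)\<^sup>2} = ball 0 1 - cball 0 (sqrt x)"
        by (auto simp: sq)
      moreover have "emeasure lborel (cball (0::complex) (sqrt x)) = ennreal (pi * x)"
        using 2 by (simp add: emeasure_cball unit_ball_vol_numeral)
      moreover have "cball (0::complex) (sqrt x) \<subseteq> ball 0 1"
        proof -
        have "sqrt x < 1" using 2 by simp
        then show ?thesis by (auto simp del: real_sqrt_lt_1_iff)
      qed
      ultimately have "emeasure ?M {x<..} = ennreal pi - ennreal (pi * x)"
        unfolding M by (simp add: emeasure_Diff ball)
      also have "\<dots> = ennreal (pi * (1 - x))"
        using 2 by (simp add: ennreal_minus algebra_simps)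
      also have "{0..1} \<inter> {x<..} = {x<..1}" using 2 by auto
      then have "ennreal (pi * (1 - x)) = emeasure ?N {x<..}"
        unfolding N using 2 by (simp add: ennreal_mult)
      finally show ?thesis .
    next
      case 3
      then have 1: "{z. cmod z < 1 \<and> x < (cmod z)\<^sup>2} = {}"
        by auto (smt (verit) norm_ge_zero power_le_one)
      have 2: "{0..1} \<inter> {x<..} = {}" using 3 by auto
      show ?thesis unfolding M N 1 2 by simp
    qed
  qed
  show "emeasure ?M {x<..} < \<infinity>" for x
  proof -
    have "emeasure ?M {x<..} \<le> emeasure lborel (ball (0::complex) 1)"
      unfolding M by (intro emeasure_mono) auto
    then show ?thesis by (simp add: ball order_le_less_trans)
  qed
qed auto

lemma nn_integral_disk_radial:
  assumes [measurable]: "q \<in> borel_measurable borel"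
  shows "(\<integral>\<^sup>+z. indicator unit_disk z * q ((cmod z)\<^sup>2) \<partial>lborel)
       = ennreal pi * (\<integral>\<^sup>+t. indicator {0..1} t * q t \<partial>lborel)"
proof -
  have "(\<integral>\<^sup>+z. indicator unit_disk z * q ((cmod z)\<^sup>2) \<partial>lborel)
      = (\<integral>\<^sup>+t. q t \<partial>distr (density lborel (indicator unit_disk)) borel (\<lambda>z::complex. (cmod z)\<^sup>2))"
    using nn_integral_density[of "indicator unit_disk" lborel "\<lambda>z::complex. q ((cmod z)\<^sup>2)"]
    by (subst nn_integral_distr) simp_all
  also have "\<dots> = ennreal pi * (\<integral>\<^sup>+t. indicator {0..1} t * q t \<partial>lborel)"
    unfolding distr_disk_norm_square
    by (subst nn_integral_density) (auto simp: nn_integral_cmult[symmetric] mult.assoc intro!: nn_integral_cong)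
  finally show ?thesis .
qed

lemma has_integral_cis_mult_int:
  fixes k :: int
  shows "((\<lambda>\<theta>. cis (of_int k * \<theta>)) has_integral (if k = 0 then 2 * pi else 0)) {0..2*pi}"
proof (cases "k = 0")
  case True
  then show ?thesis
    using has_integral_const_real[of "1::complex" 0 "2*pi"] by (simp add: scaleR_conv_of_real)
next
  case False
  have "((\<lambda>\<theta>. cis (of_int k * \<theta>)) has_integral
      (cis (of_int k * (2*pi)) / (\<i> * of_int k) - cis (of_int k * 0) / (\<i> * of_int k))) {0..2*pi}"
  proof (rule fundamental_theorem_of_calculus)
    fix x :: real
    have "((\<lambda>\<theta>. exp (\<i> * of_int k * of_real \<theta>) / (\<i> * of_int k)) has_vector_derivative
        exp (\<i> * of_int k * of_real x)) (at x within {0..2*pi})"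
      using False
      by (auto intro!: derivative_eq_intros has_vector_derivative_real_field)
    then show "((\<lambda>\<theta>. cis (of_int k * \<theta>) / (\<i> * of_int k)) has_vector_derivative cis (of_int k * x)) (at x within {0..2*pi})"
      by (simp add: cis_conv_exp mult_ac)
  qed auto
  moreover have "cis (of_int k * (2*pi)) = 1"
    using cis_multiple_2pi[of "of_int k"] by (simp add: mult_ac)
  ultimately show ?thesis using False by simp
qed

lemma has_integral_norm_square_trig_poly:
  fixes c :: "nat \<Rightarrow> complex"
  shows "((\<lambda>\<theta>. (cmod (\<Sum>m<n. c m * cis (real m * \<theta>)))\<^sup>2) has_integral (2 * pi * (\<Sum>m<n. (cmod (c m))\<^sup>2))) {0..2*pi}"
proof -
  have eq: "of_real ((cmod (\<Sum>m<n. c m * cis (real m * \<theta>)))\<^sup>2) =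
     (\<Sum>j<n. \<Sum>k<n. (c j * cnj (c k)) * cis (of_int (int j - int k) * \<theta>))" for \<theta>
  proof -
    have "cis (real j * \<theta>) * cis (- (real k * \<theta>)) = cis (of_int (int j - int k) * \<theta>)" for j k
      by (simp add: cis_mult algebra_simps)
    then show ?thesis
      unfolding complex_norm_square
      by (simp add: sum_product cis_cnj) (intro sum.cong refl, simp add: mult_ac)
  qed
  have "((\<lambda>\<theta>. \<Sum>j<n. \<Sum>k<n. (c j * cnj (c k)) * cis (of_int (int j - int k) * \<theta>)) has_integral
     (\<Sum>j<n. \<Sum>k<n. (c j * cnj (c k)) * (if int j - int k = 0 then 2 * pi else 0))) {0..2*pi}"
    by (intro has_integral_sum has_integral_mult_right has_integral_cis_mult_int) auto
  also have "(\<Sum>j<n. \<Sum>k<n. (c j * cnj (c k)) * complex_of_real (if int j - int k = 0 then 2 * pi else 0))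
      = (\<Sum>j<n. of_real (2 * pi * (cmod (c j))\<^sup>2))"
  proof (intro sum.cong refl)
    fix j assume j: "j \<in> {..<n}"
    have "(\<Sum>k<n. (c j * cnj (c k)) * complex_of_real (if int j - int k = 0 then 2 * pi else 0))
        = (\<Sum>k<n. if j = k then (c j * cnj (c k)) * of_real (2 * pi) else 0)"
      by (intro sum.cong) auto
    also have "\<dots> = c j * cnj (c j) * of_real (2 * pi)"
      using j by simp
    finally show "(\<Sum>k<n. (c j * cnj (c k)) * complex_of_real (if int j - int k = 0 then 2 * pi else 0)) = of_real (2 * pi * (cmod (c j))\<^sup>2)"
      by (simp add: complex_norm_square[symmetric] mult_ac)
  qed
  finally have "((\<lambda>\<theta>. complex_of_real ((cmod (\<Sum>m<n. c m * cis (real m * \<theta>)))\<^sup>2)) has_integral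
     (\<Sum>j<n. of_real (2 * pi * (cmod (c j))\<^sup>2))) {0..2*pi}"
    unfolding eq .
  from has_integral_linear[OF this bounded_linear_Re]
  show ?thesis by (simp add: o_def sum_distrib_left)
qed

lemma taylor_coeff_sums:
  assumes "F holomorphic_on unit_disk" "cmod z < 1"
  shows "(\<lambda>m. taylor_coeff F m * z ^ m) sums F z"
  using holomorphic_power_series[OF assms(1), of z] assms(2) by (simp add: taylor_coeff_def)

lemma summable_norm_taylor_coeff:
  assumes "F holomorphic_on unit_disk" "0 \<le> r" "r < 1"
  shows "summable (\<lambda>m. cmod (taylor_coeff F m) * r ^ m)"
proof -
  have "summable (\<lambda>m. taylor_coeff F m * of_real ((1 + r) / 2) ^ m)"
    using taylor_coeff_sums[OF assms(1), of "of_real ((1 + r) / 2)"] assms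
    by (auto simp: sums_iff norm_divide simp del: of_real_divide of_real_add)
  moreover have "norm (complex_of_real r) < norm (complex_of_real ((1 + r) / 2))"
    unfolding norm_of_real using assms by simp
  ultimately show ?thesis
    using powser_insidea[of "taylor_coeff F" "of_real ((1 + r) / 2)" "of_real r"] assms
    by (simp add: norm_mult norm_power)
qed

text \<open>On the circle the Taylor partial sums are trigonometric polynomials in the angle, all
  bounded by the absolute sum \<open>B\<close>. Dominated convergence carries their Parseval
  identity to the limit.\<close>

lemma nn_integral_circle_parseval:
  assumes hol: "F holomorphic_on unit_disk" and z: "cmod z < 1"
  shows "(\<integral>\<^sup>+\<theta>. ennreal (indicator {0..2*pi} \<theta> * (cmod (F (cis \<theta> * z)))\<^sup>2) \<partial>lborel)
       = ennreal (2 * pi) * (\<Sum>m. ennreal ((cmod (taylor_coeff F m))\<^sup>2 * ((cmod z)\<^sup>2) ^ m))"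
proof -
  define c where "c m = taylor_coeff F m * z ^ m" for m
  define f where "f = (\<lambda>n \<theta>. (cmod (\<Sum>m<n. c m * cis (real m * \<theta>)))\<^sup>2)"
  define B where "B = (\<Sum>m. cmod (c m))"
  have sc: "summable (\<lambda>m. cmod (c m))"
    using summable_norm_taylor_coeff[OF hol _ z] by (simp add: c_def norm_mult norm_power)
  have fi: "(f n has_integral (2 * pi * (\<Sum>m<n. (cmod (c m))\<^sup>2))) {0..2*pi}" for n
    unfolding f_def by (rule has_integral_norm_square_trig_poly)
  have bd: "f n \<theta> \<le> B\<^sup>2" for n \<theta>
  proof -
    have "cmod (\<Sum>m<n. c m * cis (real m * \<theta>)) \<le> (\<Sum>m<n. cmod (c m))"
      by (rule order_trans[OF norm_sum]) (simp add: norm_mult)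
    also have "\<dots> \<le> B" unfolding B_def by (rule sum_le_suminf[OF sc]) auto
    finally show ?thesis unfolding f_def by (intro power_mono) auto
  qed
  have lim: "(\<lambda>n. f n \<theta>) \<longlonglongrightarrow> (cmod (F (cis \<theta> * z)))\<^sup>2" for \<theta>
  proof -
    have "(\<lambda>n. \<Sum>m<n. c m * cis (real m * \<theta>)) \<longlonglongrightarrow> F (cis \<theta> * z)"
      using taylor_coeff_sums[OF hol, of "cis \<theta> * z"] z
      by (simp add: sums_def c_def norm_mult power_mult_distrib Complex.DeMoivre mult.commute mult.left_commute)
    then show ?thesis unfolding f_def by (intro tendsto_intros)
  qed
  have 1: "(\<lambda>\<theta>. (cmod (F (cis \<theta> * z)))\<^sup>2) integrable_on {0..2*pi}"
    and 2: "(\<lambda>n. integral {0..2*pi} (f n)) \<longlonglongrightarrow> integral {0..2*pi} (\<lambda>\<theta>. (cmod (F (cis \<theta> * z)))\<^sup>2)"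
    using dominated_convergence[of f "{0..2*pi}" "\<lambda>_. B\<^sup>2" "\<lambda>\<theta>. (cmod (F (cis \<theta> * z)))\<^sup>2"] fi bd lim
    by (auto simp: has_integral_iff f_def)
  have "(\<lambda>n. 2 * pi * (\<Sum>m<n. (cmod (c m))\<^sup>2)) \<longlonglongrightarrow> integral {0..2*pi} (\<lambda>\<theta>. (cmod (F (cis \<theta> * z)))\<^sup>2)"
    using 2 fi by (simp add: has_integral_iff)
  then have "(\<lambda>m. 2 * pi * (cmod (c m))\<^sup>2) sums integral {0..2*pi} (\<lambda>\<theta>. (cmod (F (cis \<theta> * z)))\<^sup>2)"
    by (simp add: sums_def sum_distrib_left)
  then have s: "ennreal (integral {0..2*pi} (\<lambda>\<theta>. (cmod (F (cis \<theta> * z)))\<^sup>2)) = (\<Sum>m. ennreal (2 * pi * (cmod (c m))\<^sup>2))"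
    by (intro suminf_ennreal_eq[symmetric]) auto
  have "continuous_on {0..2*pi} (\<lambda>\<theta>. (cmod (F (cis \<theta> * z)))\<^sup>2)"
    using z by (intro continuous_intros continuous_on_compose2[OF holomorphic_on_imp_continuous_on[OF hol]])
      (auto simp: norm_mult)
  then have "(\<lambda>\<theta>. indicator {0..2*pi} \<theta> * (cmod (F (cis \<theta> * z)))\<^sup>2) \<in> borel_measurable borel"
    using borel_measurable_continuous_on_indicator[of "{0..2*pi}"] by fastforce
  then have "(\<integral>\<^sup>+\<theta>. ennreal (indicator {0..2*pi} \<theta> * (cmod (F (cis \<theta> * z)))\<^sup>2) \<partial>lborel)
     = ennreal (integral {0..2*pi} (\<lambda>\<theta>. (cmod (F (cis \<theta> * z)))\<^sup>2))"
    using 1 by (subst nn_integral_eq_iff_has_integral) (auto intro!: integral_nonneg integrable_integral)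
  also note s
  also have "(\<lambda>m. ennreal (2 * pi * (cmod (c m))\<^sup>2)) = (\<lambda>m. ennreal (2 * pi) * ennreal ((cmod (taylor_coeff F m))\<^sup>2 * ((cmod z)\<^sup>2) ^ m))"
    by (auto simp: c_def norm_mult norm_power power_mult_distrib power_mult[symmetric] mult_ac ennreal_mult[symmetric] fun_eq_iff)
  finally show ?thesis by simp
qed

text \<open>The integral is invariant under rotation, so it may be averaged over all rotations; this
  is why both sides get multiplied by 2 pi. After Fubini the angular integral is Parseval on a
  circle, which removes the cross terms, and the remaining integrands are radial.\<close>

lemma nn_integral_disk_norm_square_weight:
  assumes hol: "F holomorphic_on unit_disk"
    and w [measurable]: "w \<in> borel_measurable borel" and w0: "\<And>t. 0 \<le> w t"
  shows "(\<integral>\<^sup>+z. ennreal (indicator unit_disk z * ((cmod (F z))\<^sup>2 * w ((cmod z)\<^sup>2))) \<partial>lborel)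
      = (\<Sum>m. ennreal ((cmod (taylor_coeff F m))\<^sup>2) * (ennreal pi * (\<integral>\<^sup>+t. ennreal (indicator {0..1} t * (t ^ m * w t)) \<partial>lborel)))"
proof -
  define G where "G z = indicator unit_disk z * ((cmod (F z))\<^sup>2 * w ((cmod z)\<^sup>2))" for z
  define s where "s m = (cmod (taylor_coeff F m))\<^sup>2" for m
  have G0: "0 \<le> G z" for z unfolding G_def using w0 by simp
  have [measurable]: "(\<lambda>z. indicator unit_disk z *\<^sub>R F z) \<in> borel_measurable borel"
    by (rule borel_measurable_continuous_on_indicator[OF _ holomorphic_on_imp_continuous_on[OF hol]]) auto
  have [measurable]: "G \<in> borel_measurable borel"
  proof -
    have "G = (\<lambda>z. indicator unit_disk z * ((cmod (indicator unit_disk z *\<^sub>R F z))\<^sup>2 * w ((cmod z)\<^sup>2)))"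
      by (auto simp: G_def indicator_def)
    also have "\<dots> \<in> borel_measurable borel" by measurable
    finally show ?thesis .
  qed
  have [measurable]: "cis \<in> borel_measurable borel"
    by (intro borel_measurable_continuous_onI continuous_intros)
  have Grot: "G (cis \<theta> * z) = indicator unit_disk z * w ((cmod z)\<^sup>2) * (cmod (F (cis \<theta> * z)))\<^sup>2" for \<theta> z
    by (auto simp: G_def indicator_def norm_mult)
  have "ennreal (2 * pi) * (\<integral>\<^sup>+z. ennreal (G z) \<partial>lborel)
     = (\<integral>\<^sup>+\<theta>. indicator {0..2*pi} \<theta> * (\<integral>\<^sup>+z. ennreal (G z) \<partial>lborel) \<partial>lborel)"
    by (subst nn_integral_multc) auto
  also have "\<dots> = (\<integral>\<^sup>+\<theta>. (\<integral>\<^sup>+z. indicator {0..2*pi} \<theta> * ennreal (G (cis \<theta> * z)) \<partial>lborel) \<partial>lborel)"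
  proof -
    have "(\<integral>\<^sup>+z. ennreal (G (cis \<theta> * z)) \<partial>lborel) = (\<integral>\<^sup>+z. ennreal (G z) \<partial>lborel)" for \<theta>
      by (rule nn_integral_rotation) (auto simp: G0)
    then show ?thesis by (subst nn_integral_cmult) auto
  qed
  also have "\<dots> = (\<integral>\<^sup>+z. (\<integral>\<^sup>+\<theta>. indicator {0..2*pi} \<theta> * ennreal (G (cis \<theta> * z)) \<partial>lborel) \<partial>lborel)"
    by (rule lborel_pair.Fubini'[symmetric]) simp
  also have "\<dots> = (\<integral>\<^sup>+z. ennreal (indicator unit_disk z * w ((cmod z)\<^sup>2)) *
       (ennreal (2 * pi) * (\<Sum>m. ennreal (s m * ((cmod z)\<^sup>2) ^ m))) \<partial>lborel)"
  proof (intro nn_integral_cong)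
    fix z :: complex
    show "(\<integral>\<^sup>+\<theta>. indicator {0..2*pi} \<theta> * ennreal (G (cis \<theta> * z)) \<partial>lborel)
      = ennreal (indicator unit_disk z * w ((cmod z)\<^sup>2)) *
       (ennreal (2 * pi) * (\<Sum>m. ennreal (s m * ((cmod z)\<^sup>2) ^ m)))"
    proof (cases "cmod z < 1")
      case True
      have c: "continuous_on {0..2*pi} (\<lambda>\<theta>. (cmod (F (cis \<theta> * z)))\<^sup>2)"
        using True by (intro continuous_intros continuous_on_compose2[OF holomorphic_on_imp_continuous_on[OF hol]])
          (auto simp: norm_mult)
      have m: "(\<lambda>\<theta>. indicator {0..2*pi} \<theta> * (cmod (F (cis \<theta> * z)))\<^sup>2) \<in> borel_measurable borel"
        using borel_measurable_continuous_on_indicator[OF _ c] by simp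
      have "(\<integral>\<^sup>+\<theta>. indicator {0..2*pi} \<theta> * ennreal (G (cis \<theta> * z)) \<partial>lborel)
        = (\<integral>\<^sup>+\<theta>. ennreal (indicator unit_disk z * w ((cmod z)\<^sup>2)) * ennreal (indicator {0..2*pi} \<theta> * (cmod (F (cis \<theta> * z)))\<^sup>2) \<partial>lborel)"
        using w0 by (intro nn_integral_cong) (simp add: Grot indicator_def ennreal_mult)
      also have "\<dots> = ennreal (indicator unit_disk z * w ((cmod z)\<^sup>2)) *
          (\<integral>\<^sup>+\<theta>. ennreal (indicator {0..2*pi} \<theta> * (cmod (F (cis \<theta> * z)))\<^sup>2) \<partial>lborel)"
        using m by (subst nn_integral_cmult) auto
      finally show ?thesis
        using nn_integral_circle_parseval[OF hol True] by (simp add: s_def)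
    next
      case False
      then show ?thesis by (simp add: Grot)
    qed
  qed
  also have "\<dots> = (\<integral>\<^sup>+z. (\<Sum>m. ennreal (2 * pi) * (ennreal (s m) * (indicator unit_disk z * ennreal (((cmod z)\<^sup>2)^m * w ((cmod z)\<^sup>2))))) \<partial>lborel)"
    using w0 by (intro nn_integral_cong)
      (auto simp: ennreal_suminf_cmult[symmetric] ennreal_mult s_def ennreal_indicator[symmetric] mult_ac simp del: ennreal_suminf_cmult)
  also have "\<dots> = (\<Sum>m. ennreal (2 * pi) * (ennreal (s m) * (\<integral>\<^sup>+z. indicator unit_disk z * ennreal (((cmod z)\<^sup>2)^m * w ((cmod z)\<^sup>2)) \<partial>lborel)))"
    by (subst nn_integral_suminf) (auto simp: nn_integral_cmult)
  also have "\<dots> = ennreal (2 * pi) * (\<Sum>m. ennreal (s m) * (ennreal pi * (\<integral>\<^sup>+t. ennreal (indicator {0..1} t * (t ^ m * w t)) \<partial>lborel)))"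
  proof -
    have "(\<integral>\<^sup>+z. indicator unit_disk z * ennreal (((cmod z)\<^sup>2)^m * w ((cmod z)\<^sup>2)) \<partial>lborel)
        = ennreal pi * (\<integral>\<^sup>+t. ennreal (indicator {0..1} t * (t ^ m * w t)) \<partial>lborel)" for m
    proof -
      have "ennreal (indicator {0..1} t * (t ^ m * w t)) = indicator {0..1} t * ennreal (t ^ m * w t)" for t
        by (auto simp: indicator_def)
      then show ?thesis
        using nn_integral_disk_radial[of "\<lambda>t. ennreal (t ^ m * w t)"] by simp
    qed
    then show ?thesis by simp
  qed
  finally show ?thesis
    by (simp add: G_def s_def ennreal_mult_cancel_left)
qed

lemma nn_integral_Beta:
  assumes "-1 < \<beta>"
  shows "(\<integral>\<^sup>+t. ennreal (indicator {0..1} t * (t ^ m * (1 - t) powr \<beta>)) \<partial>lborel)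
       = ennreal (Beta (real m + 1) (\<beta> + 1))"
proof (subst nn_integral_eq_iff_has_integral)
  have "((\<lambda>t. t powr (real m) * (1 - t) powr \<beta>) has_integral Beta (real m + 1) (\<beta> + 1)) {0..1}"
    using has_integral_Beta_real[of "real m + 1" "\<beta> + 1"] assms by simp
  \<comment> \<open>For m = 0 the two powers disagree at t = 0, where \<open>0 powr 0 = 0\<close>.
    The endpoints are dropped before \<open>powr\<close> is replaced.\<close>
  then have "((\<lambda>t. t powr (real m) * (1 - t) powr \<beta>) has_integral Beta (real m + 1) (\<beta> + 1)) {0<..<1}"
    by (simp add: has_integral_Icc_iff_Ioo)
  then have "((\<lambda>t. t ^ m * (1 - t) powr \<beta>) has_integral Beta (real m + 1) (\<beta> + 1)) {0<..<1}"
    by (rule has_integral_eq[rotated]) (auto simp: powr_realpow)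
  then show "((\<lambda>t. t ^ m * (1 - t) powr \<beta>) has_integral Beta (real m + 1) (\<beta> + 1)) {0..1}"
    by (simp add: has_integral_Icc_iff_Ioo)
qed (use assms in \<open>auto simp: Beta_def\<close>)

section \<open>Sobolev-type norms and membership in \<open>A2\<close>\<close>

text \<open>The ratio and its inverse both converge, hence are bounded over all indices. Positivity
  of every term then gives constants valid from n = 0 on, not just eventually.\<close>

lemma tendsto_ratio_imp_comparable:
  fixes u v :: "nat \<Rightarrow> real"
  assumes lim: "(\<lambda>n. u n / v n) \<longlonglongrightarrow> L" and "0 < L" and u: "\<And>n. 0 < u n" and v: "\<And>n. 0 < v n"
  obtains c C where "0 < c" "0 < C" "\<And>n. c * v n \<le> u n" "\<And>n. u n \<le> C * v n"
proof -
  have "Bseq (\<lambda>n. u n / v n)" using lim by (intro convergent_imp_Bseq convergentI)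
  then obtain C where C: "0 < C" "\<And>n. u n / v n \<le> C"
    by (auto simp: Bseq_def abs_of_pos[OF u] abs_of_pos[OF v])
  have "(\<lambda>n. inverse (u n / v n)) \<longlonglongrightarrow> inverse L" using lim \<open>0 < L\<close> by (intro tendsto_intros) auto
  then have "Bseq (\<lambda>n. inverse (u n / v n))" by (intro convergent_imp_Bseq convergentI)
  then obtain D where D: "0 < D" "\<And>n. inverse (u n / v n) \<le> D"
    by (auto simp: Bseq_def abs_of_pos[OF u] abs_of_pos[OF v])
  show ?thesis
  proof
    show "0 < inverse D" "0 < C" using C D by auto
    show "u n \<le> C * v n" for n using C(2)[of n] v[of n] by (simp add: field_simps)
    show "inverse D * v n \<le> u n" for n using D(2)[of n] D(1) u[of n] v[of n] by (simp add: field_simps)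
  qed
qed

text \<open>The quotient is the m-th coefficient of (1 - x)^(-s). Up to the shift m = n + 1 and a
  factor tending to 1 it is the Euler limit for 1/Gamma.\<close>

lemma pochhammer_div_fact_asymp:
  fixes s :: real
  shows "(\<lambda>m. pochhammer s m / fact m / (real m + 1) powr (s - 1)) \<longlonglongrightarrow> rGamma s"
proof (rule LIMSEQ_imp_Suc)
  have "(\<lambda>n. rGamma_series s n * (real n powr s / ((real n + 1) * (real n + 2) powr (s - 1)))) \<longlonglongrightarrow> rGamma s * 1"
  proof (intro tendsto_mult rGamma_series_LIMSEQ)
    show "(\<lambda>n. real n powr s / ((real n + 1) * (real n + 2) powr (s - 1))) \<longlonglongrightarrow> 1"
      by real_asymp
  qed
  moreover have "eventually (\<lambda>n. rGamma_series s n * (real n powr s / ((real n + 1) * (real n + 2) powr (s - 1)))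
       = pochhammer s (Suc n) / fact (Suc n) / (real (Suc n) + 1) powr (s - 1)) sequentially"
    using eventually_gt_at_top[of 0]
  proof eventually_elim
    case (elim n)
    then have "exp (s * ln (real n)) = real n powr s" "real n powr s \<noteq> 0" by (auto simp: powr_def)
    then show ?case by (simp add: rGamma_series_def add.commute field_simps)
  qed
  ultimately show "(\<lambda>n. pochhammer s (Suc n) / fact (Suc n) / (real (Suc n) + 1) powr (s - 1)) \<longlonglongrightarrow> rGamma s"
    using Lim_transform_eventually by fastforce
qed

text \<open>The Beta value equals n! divided by the Pochhammer symbol of b of length n + 1, which is
  the Euler limit for Gamma up to the factor n^b.\<close>

lemma Beta_Suc_asymp:
  fixes b :: real
  assumes "0 < b"
  shows "(\<lambda>m. Beta (real m + 1) b / (real m + 1) powr (- b)) \<longlonglongrightarrow> Gamma b"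
proof -
  have "(\<lambda>n. Gamma_series b n * ((real n + 1) powr b / real n powr b)) \<longlonglongrightarrow> Gamma b * 1"
  proof (intro tendsto_mult Gamma_series_LIMSEQ)
    show "(\<lambda>n. (real n + 1) powr b / real n powr b) \<longlonglongrightarrow> 1"
      by real_asymp
  qed
  moreover have "eventually (\<lambda>n. Gamma_series b n * ((real n + 1) powr b / real n powr b)
       = Beta (real n + 1) b / (real n + 1) powr (- b)) sequentially"
    using eventually_gt_at_top[of 0]
  proof eventually_elim
    case (elim n)
    then have 1: "exp (b * ln (real n)) = real n powr b" "real n powr b \<noteq> 0" by (auto simp: powr_def)
    have "Gamma (real n + 1) = fact n" using Gamma_fact[of n, where 'a=real] by (simp add: add.commute)
    moreover have "b \<notin> \<int>\<^sub>\<le>\<^sub>0" using assms by (auto elim!: nonpos_Ints_cases)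
    then have "pochhammer b (n + 1) = Gamma (b + (real n + 1)) / Gamma b"
      using pochhammer_Gamma[of b "n + 1"] by (simp add: add_ac)
    ultimately have "Beta (real n + 1) b = fact n / pochhammer b (n + 1)"
      using assms by (simp add: Beta_def add_ac)
    then show ?case using 1 by (simp add: Gamma_series_def powr_minus field_simps)
  qed
  ultimately show ?thesis
    using Lim_transform_eventually by fastforce
qed

text \<open>A Sobolev-type norm that makes sense for every real \<alpha>. With values in
  \<open>ennreal\<close>, divergence is simply infinity and estimates need no summability side
  conditions. The base \<open>real m + 1\<close> keeps the weight positive at m = 0.\<close>

definition weighted_norm2 :: "real \<Rightarrow> (complex \<Rightarrow> complex) \<Rightarrow> ennreal" where
  "weighted_norm2 \<alpha> f = (\<Sum>m. ennreal ((cmod (taylor_coeff f m))\<^sup>2 * (real m + 1) powr (- (\<alpha> + 1))))"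

definition disk_norm2 :: "real \<Rightarrow> (complex \<Rightarrow> complex) \<Rightarrow> ennreal" where
  "disk_norm2 \<beta> f = (\<integral>\<^sup>+z. ennreal (indicator unit_disk z * ((cmod (f z))\<^sup>2 * (1 - (cmod z)\<^sup>2) powr \<beta>)) \<partial>lborel)"

lemma suminf_ennreal_weight_mono:
  assumes "\<And>m. u m \<le> c * v m" "0 \<le> c" "\<And>m. 0 \<le> v m" "\<And>m. 0 \<le> s m"
  shows "(\<Sum>m. ennreal (s m * u m)) \<le> ennreal c * (\<Sum>m. ennreal (s m * v m))"
proof -
  have "(\<Sum>m. ennreal (s m * u m)) \<le> (\<Sum>m. ennreal c * ennreal (s m * v m))"
  proof (rule suminf_le)
    fix m
    have "s m * u m \<le> c * (s m * v m)"
      using mult_left_mono[OF assms(1) assms(4), of m m] by (simp add: mult_ac)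
    then show "ennreal (s m * u m) \<le> ennreal c * ennreal (s m * v m)"
      using assms by (simp add: ennreal_mult[symmetric] ennreal_leI)
  qed auto
  then show ?thesis by simp
qed

text \<open>The area norm is a weighted coefficient sum with weights pi B(m + 1, \<beta> + 1), and
  these are comparable to the powers in \<open>weighted_norm2\<close>. The constants do not depend
  on f.\<close>

lemma disk_norm2_comparable:
  assumes "-1 < \<beta>"
  obtains c C where "0 < c" "0 < C"
    "\<And>f. f holomorphic_on unit_disk \<Longrightarrow> weighted_norm2 \<beta> f \<le> ennreal c * disk_norm2 \<beta> f"
    "\<And>f. f holomorphic_on unit_disk \<Longrightarrow> disk_norm2 \<beta> f \<le> ennreal C * weighted_norm2 \<beta> f"
proof -
  define B where "B m = pi * Beta (real m + 1) (\<beta> + 1)" for m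
  have B: "0 < B m" for m using assms by (simp add: B_def Beta_def)
  have "(\<lambda>m. pi * (Beta (real m + 1) (\<beta> + 1) / (real m + 1) powr (- (\<beta> + 1)))) \<longlonglongrightarrow> pi * Gamma (\<beta> + 1)"
    using assms by (intro tendsto_mult_left Beta_Suc_asymp) simp
  then have lim: "(\<lambda>m. B m / (real m + 1) powr (- (\<beta> + 1))) \<longlonglongrightarrow> pi * Gamma (\<beta> + 1)"
    by (simp add: B_def)
  obtain c C where cC: "0 < c" "0 < C"
    "\<And>n. c * (real n + 1) powr (- (\<beta> + 1)) \<le> B n" "\<And>n. B n \<le> C * (real n + 1) powr (- (\<beta> + 1))"
    by (rule tendsto_ratio_imp_comparable[OF lim]) (use B assms in auto)
  have dn: "disk_norm2 \<beta> f = (\<Sum>m. ennreal ((cmod (taylor_coeff f m))\<^sup>2 * B m))" if "f holomorphic_on unit_disk" for f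
  proof -
    have "disk_norm2 \<beta> f = (\<Sum>m. ennreal ((cmod (taylor_coeff f m))\<^sup>2) * (ennreal pi * ennreal (Beta (real m + 1) (\<beta> + 1))))"
      unfolding disk_norm2_def
      by (subst nn_integral_disk_norm_square_weight[OF that, of "\<lambda>t. (1 - t) powr \<beta>"])
        (use nn_integral_Beta[OF assms] in auto)
    moreover have "0 \<le> Beta (real m + 1) (\<beta> + 1)" for m using assms by (simp add: Beta_def)
    ultimately show ?thesis by (simp add: B_def ennreal_mult)
  qed
  show ?thesis
  proof
    show "0 < inverse c" "0 < C" using cC by auto
    fix f assume f: "f holomorphic_on unit_disk"
    show "disk_norm2 \<beta> f \<le> ennreal C * weighted_norm2 \<beta> f"
      unfolding dn[OF f] weighted_norm2_def
      by (rule suminf_ennreal_weight_mono) (use cC in auto)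
    have "(real m + 1) powr (- (\<beta> + 1)) \<le> inverse c * B m" for m
      using cC(1) cC(3)[of m] by (simp add: field_simps)
    then show "weighted_norm2 \<beta> f \<le> ennreal (inverse c) * disk_norm2 \<beta> f"
      unfolding dn[OF f] weighted_norm2_def
      by (intro suminf_ennreal_weight_mono) (use cC B in \<open>auto intro: less_imp_le\<close>)
  qed
qed

section \<open>The coefficient norm under differentiation, and membership in
  \<open>A2\<close>\<close>

lemma taylor_coeff_deriv: "taylor_coeff (deriv f) m = of_nat (m + 1) * taylor_coeff f (m + 1)"
  by (simp add: taylor_coeff_def funpow_swap1 fact_reduce del: of_nat_Suc)

text \<open>Since x \<le> x + 1 \<le> 2 x, an index shift costs at most the factor 2^|p|.
  Differentiation shifts the Taylor coefficients by one, which is where such a factor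
  arises.\<close>

lemma powr_Suc_comparable:
  fixes x p :: real
  assumes "1 \<le> x"
  shows "x powr p \<le> 2 powr \<bar>p\<bar> * (x + 1) powr p" "(x + 1) powr p \<le> 2 powr \<bar>p\<bar> * x powr p"
proof -
  have x: "x \<le> x + 1" "x + 1 \<le> 2 * x" "0 < x" using assms by auto
  have g: "y \<le> 2 powr \<bar>p\<bar> * y" if "0 \<le> y" for y
    using mult_right_mono[OF ge_one_powr_ge_zero[of 2 "\<bar>p\<bar>"] that] by simp
  have "x powr p \<le> 2 powr \<bar>p\<bar> * (x + 1) powr p \<and> (x + 1) powr p \<le> 2 powr \<bar>p\<bar> * x powr p"
  proof (cases "0 \<le> p")
    case True
    have a: "x powr p \<le> (x + 1) powr p" using True x by (intro powr_mono2) auto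
    have "(x + 1) powr p \<le> (2 * x) powr p" using True x by (intro powr_mono2) auto
    moreover have "x powr p \<le> 2 powr \<bar>p\<bar> * (x + 1) powr p" using a g[of "(x+1) powr p"] by simp
    ultimately show ?thesis using True x by (simp add: powr_mult)
  next
    case False
    have a: "(x + 1) powr p \<le> x powr p" using False x by (intro powr_mono2') auto
    have "(2 * x) powr p \<le> (x + 1) powr p" using False x by (intro powr_mono2') auto
    then have "2 powr \<bar>p\<bar> * (2 powr p * x powr p) \<le> 2 powr \<bar>p\<bar> * (x + 1) powr p" using x by (simp add: powr_mult)
    moreover have "2 powr \<bar>p\<bar> * (2 powr p * x powr p) = x powr p" using False by (simp add: powr_minus)
    moreover have "(x + 1) powr p \<le> 2 powr \<bar>p\<bar> * x powr p" using a g[of "x powr p"] by simp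
    ultimately show ?thesis by simp
  qed
  then show "x powr p \<le> 2 powr \<bar>p\<bar> * (x + 1) powr p" "(x + 1) powr p \<le> 2 powr \<bar>p\<bar> * x powr p" by auto
qed

lemma weighted_norm2_split:
  "weighted_norm2 \<alpha> f = ennreal ((cmod (f 0))\<^sup>2) +
     (\<Sum>m. ennreal ((cmod (taylor_coeff f (Suc m)))\<^sup>2 * (real m + 2) powr (- (\<alpha> + 1))))"
  unfolding weighted_norm2_def
  by (subst suminf_offset[of _ 1]) (auto simp: taylor_coeff_def add_ac)

text \<open>The factor (m + 1)^2 produced by the derivative cancels the increase of \<alpha> by 2
  exactly; only the index shift is left.\<close>

lemma weighted_norm2_deriv_eq:
  "weighted_norm2 (\<alpha> + 2) (deriv f) =
     (\<Sum>m. ennreal ((cmod (taylor_coeff f (Suc m)))\<^sup>2 * (real m + 1) powr (- (\<alpha> + 1))))"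
proof -
  have "(cmod (taylor_coeff (deriv f) m))\<^sup>2 * (real m + 1) powr (- (\<alpha> + 2 + 1))
      = (cmod (taylor_coeff f (Suc m)))\<^sup>2 * (real m + 1) powr (- (\<alpha> + 1))" for m
  proof -
    have "(real m + 1) powr (- (\<alpha> + 1)) = (real m + 1) powr 2 * (real m + 1) powr (- (\<alpha> + 2 + 1))"
      unfolding powr_add[symmetric] by (simp add: algebra_simps)
    then have "(real m + 1) powr (- (\<alpha> + 1)) = (real m + 1)^2 * (real m + 1) powr (- (\<alpha> + 2 + 1))"
      by simp
    moreover have "cmod (of_nat (m + 1)) = real m + 1" by (simp del: of_nat_Suc of_nat_add)
    ultimately show ?thesis
      by (simp only: taylor_coeff_deriv norm_mult power_mult_distrib) simp
  qed
  then show ?thesis unfolding weighted_norm2_def by simp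
qed

lemma weighted_norm2_deriv_le:
  "weighted_norm2 (\<alpha> + 2) (deriv f) \<le> ennreal (2 powr \<bar>\<alpha> + 1\<bar>) * weighted_norm2 \<alpha> f"
proof -
  have "weighted_norm2 (\<alpha> + 2) (deriv f) \<le> ennreal (2 powr \<bar>\<alpha> + 1\<bar>) *
     (\<Sum>m. ennreal ((cmod (taylor_coeff f (Suc m)))\<^sup>2 * (real m + 2) powr (- (\<alpha> + 1))))"
    unfolding weighted_norm2_deriv_eq
    by (rule suminf_ennreal_weight_mono)
      (use powr_Suc_comparable(1)[of "real _ + 1" "- (\<alpha> + 1)", unfolded abs_minus_cancel] in \<open>auto simp: add_ac\<close>)
  also have "\<dots> \<le> ennreal (2 powr \<bar>\<alpha> + 1\<bar>) * weighted_norm2 \<alpha> f"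
    unfolding weighted_norm2_split by (intro mult_left_mono) auto
  finally show ?thesis .
qed

text \<open>The derivative forgets the constant term, which therefore enters separately.\<close>

lemma weighted_norm2_le_deriv:
  "weighted_norm2 \<alpha> f \<le> ennreal ((cmod (f 0))\<^sup>2) + ennreal (2 powr \<bar>\<alpha> + 1\<bar>) * weighted_norm2 (\<alpha> + 2) (deriv f)"
  by (subst weighted_norm2_split, subst weighted_norm2_deriv_eq, intro add_left_mono suminf_ennreal_weight_mono)
    (use powr_Suc_comparable(2)[of "real _ + 1" "- (\<alpha> + 1)", unfolded abs_minus_cancel] in \<open>auto simp: add_ac\<close>)

lemma weighted_norm2_higher_deriv_finite:
  "weighted_norm2 (\<alpha> + 2 * real k) ((deriv ^^ k) f) < \<infinity> \<longleftrightarrow> weighted_norm2 \<alpha> f < \<infinity>"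
proof (induction k)
  case (Suc k)
  have *: "weighted_norm2 (\<gamma> + 2) (deriv g) < \<infinity> \<longleftrightarrow> weighted_norm2 \<gamma> g < \<infinity>" for \<gamma> g
  proof
    assume "weighted_norm2 (\<gamma> + 2) (deriv g) < \<infinity>"
    then have "ennreal ((cmod (g 0))\<^sup>2) + ennreal (2 powr \<bar>\<gamma> + 1\<bar>) * weighted_norm2 (\<gamma> + 2) (deriv g) < \<infinity>"
      by (auto simp: ennreal_mult_less_top)
    then show "weighted_norm2 \<gamma> g < \<infinity>"
      using weighted_norm2_le_deriv[of \<gamma> g] by (rule le_less_trans[rotated])
  next
    assume "weighted_norm2 \<gamma> g < \<infinity>"
    then have "ennreal (2 powr \<bar>\<gamma> + 1\<bar>) * weighted_norm2 \<gamma> g < \<infinity>"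
      by (auto simp: ennreal_mult_less_top)
    then show "weighted_norm2 (\<gamma> + 2) (deriv g) < \<infinity>"
      using weighted_norm2_deriv_le[of \<gamma> g] by (rule le_less_trans[rotated])
  qed
  show ?case
    using *[of "\<alpha> + 2 * real k" "(deriv ^^ k) f"] Suc by (simp add: algebra_simps)
qed simp

text \<open>The squared factor (1 - |z|^2)^(2k) merges with the weight into the exponent \<alpha> +
  2k, which is precisely the shift caused by k derivatives. The right-hand side is free of
  k.\<close>

lemma set_integrable_disk_iff:
  assumes hol: "f holomorphic_on unit_disk" and \<beta>: "-1 < \<alpha> + 2 * real k"
  shows "set_integrable lborel unit_disk
          (\<lambda>z. (cmod ((1 - (cmod z)\<^sup>2) ^ k * (deriv ^^ k) f z))\<^sup>2 * (1 - (cmod z)\<^sup>2) powr \<alpha>)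
     \<longleftrightarrow> weighted_norm2 \<alpha> f < \<infinity>"
proof -
  define F where "F = (deriv ^^ k) f"
  have F: "F holomorphic_on unit_disk" unfolding F_def by (intro holomorphic_higher_deriv hol) auto
  have [measurable]: "(\<lambda>z. indicator unit_disk z *\<^sub>R F z) \<in> borel_measurable borel"
    by (rule borel_measurable_continuous_on_indicator[OF _ holomorphic_on_imp_continuous_on[OF F]]) auto
  define G where "G z = indicator unit_disk z * ((cmod (F z))\<^sup>2 * (1 - (cmod z)\<^sup>2) powr (\<alpha> + 2 * real k))" for z
  have Geq: "indicator unit_disk z *\<^sub>R ((cmod ((1 - (cmod z)\<^sup>2) ^ k * F z))\<^sup>2 * (1 - (cmod z)\<^sup>2) powr \<alpha>) = G z" for z
  proof (cases "z \<in> unit_disk")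
    case True
    then have "0 < 1 - (cmod z)\<^sup>2" by (simp add: power_less_one_iff)
    then have "((1 - (cmod z)\<^sup>2) ^ k)\<^sup>2 * (1 - (cmod z)\<^sup>2) powr \<alpha> = (1 - (cmod z)\<^sup>2) powr (\<alpha> + 2 * real k)"
      by (simp add: powr_add powr_realpow[symmetric] powr_powr[symmetric] power2_eq_square mult_ac flip: powr_realpow)
    moreover have "cmod (1 - (complex_of_real (cmod z))\<^sup>2) = 1 - (cmod z)\<^sup>2"
      using \<open>0 < 1 - (cmod z)\<^sup>2\<close> norm_of_real[of "1 - (cmod z)\<^sup>2", where 'a=complex] by simp
    ultimately show ?thesis using True
      by (simp add: G_def norm_mult norm_power power_mult_distrib mult_ac)
  qed (simp add: G_def)
  have "G \<in> borel_measurable borel"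
  proof -
    have "G = (\<lambda>z. indicator unit_disk z * ((cmod (indicator unit_disk z *\<^sub>R F z))\<^sup>2 * (1 - (cmod z)\<^sup>2) powr (\<alpha> + 2 * real k)))"
      by (auto simp: G_def indicator_def)
    also have "\<dots> \<in> borel_measurable borel" by measurable
    finally show ?thesis .
  qed
  moreover have "0 \<le> G z" for z by (simp add: G_def)
  ultimately have "integrable lborel G \<longleftrightarrow> (\<integral>\<^sup>+z. ennreal (G z) \<partial>lborel) < \<infinity>"
    by (simp add: integrable_iff_bounded)
  also have "(\<integral>\<^sup>+z. ennreal (G z) \<partial>lborel) = disk_norm2 (\<alpha> + 2 * real k) F"
    by (simp add: G_def disk_norm2_def)
  also have "\<dots> < \<infinity> \<longleftrightarrow> weighted_norm2 (\<alpha> + 2 * real k) F < \<infinity>"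
  proof -
    obtain c C where "weighted_norm2 (\<alpha> + 2 * real k) F \<le> ennreal c * disk_norm2 (\<alpha> + 2 * real k) F"
       "disk_norm2 (\<alpha> + 2 * real k) F \<le> ennreal C * weighted_norm2 (\<alpha> + 2 * real k) F"
      using disk_norm2_comparable[OF \<beta>] F by metis
    then show ?thesis
      by (metis ennreal_less_top ennreal_mult_less_top infinity_ennreal_def le_less_trans)
  qed
  also have "\<dots> \<longleftrightarrow> weighted_norm2 \<alpha> f < \<infinity>"
    unfolding F_def by (rule weighted_norm2_higher_deriv_finite)
  finally show ?thesis
    unfolding set_integrable_def F_def[symmetric] using Geq by simp
qed

text \<open>All admissible k impose the same condition, and an admissible k exists for every real
  \<alpha>.\<close>

lemma A2_iff:
  "f \<in> A2 \<alpha> \<longleftrightarrow> f holomorphic_on unit_disk \<and> (\<forall>z. z \<notin> unit_disk \<longrightarrow> f z = 0) \<and> weighted_norm2 \<alpha> f < \<infinity>"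
proof -
  obtain k :: nat where "- 1 - \<alpha> < 2 * real k"
    using reals_Archimedean2[of "(- 1 - \<alpha>) / 2"] by (auto simp: field_simps)
  then have "-1 < \<alpha> + 2 * real k" by simp
  then show ?thesis
    unfolding A2_def using set_integrable_disk_iff by blast
qed

section \<open>Elementary estimates for the coefficient norm and for point evaluations\<close>

lemma summable_geometric_powr:
  fixes r p :: real
  assumes "0 \<le> r" "r < 1"
  shows "summable (\<lambda>m. r ^ m * (real m + 1) powr p)"
proof (cases "r = 0")
  case True
  then show ?thesis by (intro summable_finite[of "{0}"]) auto
next
  case False
  have "(\<lambda>m. r * ((real m + 2) powr p / (real m + 1) powr p)) \<longlonglongrightarrow> r * 1"
  proof (intro tendsto_mult tendsto_const)
    show "(\<lambda>m. (real m + 2) powr p / (real m + 1) powr p) \<longlonglongrightarrow> 1" by real_asymp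
  qed
  then have "eventually (\<lambda>m. r * ((real m + 2) powr p / (real m + 1) powr p) < (1 + r) / 2) sequentially"
    by (rule order_tendstoD) (use assms in simp)
  then obtain M where M: "\<And>m. m \<ge> M \<Longrightarrow> r * ((real m + 2) powr p / (real m + 1) powr p) < (1 + r) / 2"
    by (auto simp: eventually_sequentially)
  show ?thesis
  proof (rule summable_ratio_test[of "(1 + r) / 2" M])
    fix m assume "M \<le> m"
    then have "r * (real m + 2) powr p \<le> (1 + r) / 2 * (real m + 1) powr p"
      using M[of m] by (simp add: field_simps)
    then have "r ^ m * (r * (real m + 2) powr p) \<le> r ^ m * ((1 + r) / 2 * (real m + 1) powr p)"
      using assms by (intro mult_left_mono) auto
    then show "norm (r ^ Suc m * (real (Suc m) + 1) powr p) \<le> (1 + r) / 2 * norm (r ^ m * (real m + 1) powr p)"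
      using assms by (simp add: abs_mult mult_ac add_ac)
  qed (use assms in auto)
qed

lemma taylor_coeff_cong:
  assumes "\<And>z. cmod z < 1 \<Longrightarrow> f z = g z"
  shows "taylor_coeff f m = taylor_coeff g m"
proof -
  have "eventually (\<lambda>z. f z = g z) (nhds 0)"
    using assms by (intro eventually_nhds_in_open[of unit_disk, THEN eventually_mono]) auto
  then show ?thesis by (simp add: taylor_coeff_def higher_deriv_cong_ev)
qed

lemma weighted_norm2_cong:
  assumes "\<And>z. cmod z < 1 \<Longrightarrow> f z = g z"
  shows "weighted_norm2 \<alpha> f = weighted_norm2 \<alpha> g"
  unfolding weighted_norm2_def using taylor_coeff_cong[OF assms] by simp

lemma taylor_coeff_add:
  assumes "f holomorphic_on unit_disk" "g holomorphic_on unit_disk"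
  shows "taylor_coeff (\<lambda>z. f z + g z) m = taylor_coeff f m + taylor_coeff g m"
  using higher_deriv_add[OF assms, of 0 m] by (simp add: taylor_coeff_def add_divide_distrib)

lemma taylor_coeff_cmult:
  assumes "f holomorphic_on unit_disk"
  shows "taylor_coeff (\<lambda>z. c * f z) m = c * taylor_coeff f m"
  using higher_deriv_cmult[OF assms, of 0 m c] by (simp add: taylor_coeff_def)

lemma weighted_norm2_add_le:
  assumes "f holomorphic_on unit_disk" "g holomorphic_on unit_disk"
  shows "weighted_norm2 \<alpha> (\<lambda>z. f z + g z) \<le> 2 * weighted_norm2 \<alpha> f + 2 * weighted_norm2 \<alpha> g"
proof -
  have *: "(cmod (x + y))\<^sup>2 \<le> 2 * (cmod x)\<^sup>2 + 2 * (cmod y)\<^sup>2" for x y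
  proof -
    have "(cmod (x + y))\<^sup>2 \<le> (cmod x + cmod y)\<^sup>2" by (intro power_mono norm_triangle_ineq) auto
    also have "\<dots> \<le> 2 * (cmod x)\<^sup>2 + 2 * (cmod y)\<^sup>2"
      using sum_squares_bound[of "cmod x" "cmod y"] by (simp add: power2_sum)
    finally show ?thesis .
  qed
  have "weighted_norm2 \<alpha> (\<lambda>z. f z + g z) \<le>
    (\<Sum>m. 2 * ennreal ((cmod (taylor_coeff f m))\<^sup>2 * (real m + 1) powr (- (\<alpha> + 1))) +
         2 * ennreal ((cmod (taylor_coeff g m))\<^sup>2 * (real m + 1) powr (- (\<alpha> + 1))))"
    unfolding weighted_norm2_def
  proof (rule suminf_le)
    fix m
    have "(cmod (taylor_coeff f m + taylor_coeff g m))\<^sup>2 * (real m + 1) powr (- (\<alpha> + 1)) \<le>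
      (2 * (cmod (taylor_coeff f m))\<^sup>2 + 2 * (cmod (taylor_coeff g m))\<^sup>2) * (real m + 1) powr (- (\<alpha> + 1))"
      by (intro mult_right_mono *) auto
    then have "ennreal ((cmod (taylor_coeff f m + taylor_coeff g m))\<^sup>2 * (real m + 1) powr (- (\<alpha> + 1))) \<le>
      ennreal (2 * ((cmod (taylor_coeff f m))\<^sup>2 * (real m + 1) powr (- (\<alpha> + 1))) +
        2 * ((cmod (taylor_coeff g m))\<^sup>2 * (real m + 1) powr (- (\<alpha> + 1))))"
      by (intro ennreal_leI) (simp add: algebra_simps)
    then show "ennreal ((cmod (taylor_coeff (\<lambda>z. f z + g z) m))\<^sup>2 * (real m + 1) powr (- (\<alpha> + 1))) \<le>
      2 * ennreal ((cmod (taylor_coeff f m))\<^sup>2 * (real m + 1) powr (- (\<alpha> + 1))) +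
         2 * ennreal ((cmod (taylor_coeff g m))\<^sup>2 * (real m + 1) powr (- (\<alpha> + 1)))"
      by (simp add: taylor_coeff_add[OF assms] ennreal_mult)
  qed auto
  also have "\<dots> = 2 * weighted_norm2 \<alpha> f + 2 * weighted_norm2 \<alpha> g"
    by (simp add: suminf_add[symmetric] weighted_norm2_def)
  finally show ?thesis .
qed

lemma weighted_norm2_antimono:
  assumes "\<alpha> \<le> \<beta>"
  shows "weighted_norm2 \<beta> f \<le> weighted_norm2 \<alpha> f"
  unfolding weighted_norm2_def
  by (intro suminf_le ennreal_leI mult_left_mono powr_mono) (use assms in auto)

lemma weighted_norm2_bounds_coeff:
  assumes "weighted_norm2 \<alpha> f < \<infinity>"
  shows "cmod (taylor_coeff f m) \<le> sqrt (enn2real (weighted_norm2 \<alpha> f)) * (real m + 1) powr ((\<alpha> + 1) / 2)"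
proof -
  have "ennreal ((cmod (taylor_coeff f m))\<^sup>2 * (real m + 1) powr (- (\<alpha> + 1))) \<le> weighted_norm2 \<alpha> f"
    unfolding weighted_norm2_def
    by (rule order_trans[OF _ sum_le_suminf[OF summableI, of "{m}"]]) simp_all
  also have "\<dots> = ennreal (enn2real (weighted_norm2 \<alpha> f))" using assms by simp
  finally have "(cmod (taylor_coeff f m))\<^sup>2 * (real m + 1) powr (- (\<alpha> + 1)) \<le> enn2real (weighted_norm2 \<alpha> f)"
    by (subst (asm) ennreal_le_iff) auto
  then have "(cmod (taylor_coeff f m))\<^sup>2 \<le> enn2real (weighted_norm2 \<alpha> f) * (real m + 1) powr (\<alpha> + 1)"
    unfolding powr_minus divide_inverse[symmetric] by (subst (asm) pos_divide_le_eq) auto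
  also have "(real m + 1) powr (\<alpha> + 1) = ((real m + 1) powr ((\<alpha> + 1) / 2))\<^sup>2"
    by (simp add: power2_eq_square powr_add[symmetric])
  finally have "sqrt ((cmod (taylor_coeff f m))\<^sup>2) \<le> sqrt (enn2real (weighted_norm2 \<alpha> f) * ((real m + 1) powr ((\<alpha> + 1) / 2))\<^sup>2)"
    by (rule real_sqrt_le_mono)
  then show ?thesis by (simp add: real_sqrt_mult)
qed

text \<open>A finite norm forces polynomial growth of the coefficients, which the geometric factor
  |w|^m beats. The bound at \<phi>(0) controls the constant term of a weighted composition.\<close>

lemma point_evaluation_bounded:
  assumes "cmod w < 1"
  obtains P where "0 < P" "\<And>f. f holomorphic_on unit_disk \<Longrightarrow> ennreal ((cmod (f w))\<^sup>2) \<le> ennreal P * weighted_norm2 \<alpha> f"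
proof -
  define S where "S = (\<Sum>m. cmod w ^ m * (real m + 1) powr ((\<alpha> + 1) / 2))"
  have sS: "summable (\<lambda>m. cmod w ^ m * (real m + 1) powr ((\<alpha> + 1) / 2))"
    using assms by (intro summable_geometric_powr) auto
  have S0: "0 \<le> S" unfolding S_def by (intro suminf_nonneg sS) auto
  show ?thesis
  proof
    \<comment> \<open>The added 1 guarantees positivity, which matters for functions of infinite
      norm because \<open>0 * top = 0\<close> in \<open>ennreal\<close>.\<close>
    show "0 < S\<^sup>2 + 1" by (simp add: add_nonneg_pos)
    fix f assume hol: "f holomorphic_on unit_disk"
    show "ennreal ((cmod (f w))\<^sup>2) \<le> ennreal (S\<^sup>2 + 1) * weighted_norm2 \<alpha> f"
    proof (cases "weighted_norm2 \<alpha> f < \<infinity>")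
      case True
      define n where "n = enn2real (weighted_norm2 \<alpha> f)"
      have n: "weighted_norm2 \<alpha> f = ennreal n" "0 \<le> n" using True by (auto simp: n_def)
      have s: "(\<lambda>m. taylor_coeff f m * w ^ m) sums f w" using taylor_coeff_sums[OF hol assms] .
      have le: "cmod (taylor_coeff f m * w ^ m) \<le> sqrt n * (cmod w ^ m * (real m + 1) powr ((\<alpha> + 1) / 2))" for m
        using mult_right_mono[OF weighted_norm2_bounds_coeff[OF True, of m], of "cmod w ^ m"]
        by (simp add: norm_mult norm_power n_def mult_ac)
      have "cmod (f w) \<le> (\<Sum>m. sqrt n * (cmod w ^ m * (real m + 1) powr ((\<alpha> + 1) / 2)))"
        using norm_suminf_le[of "\<lambda>m. taylor_coeff f m * w ^ m", OF le] s sS by (simp add: sums_iff summable_mult)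
      also have "\<dots> = sqrt n * S" unfolding S_def using sS by (rule suminf_mult)
      finally have "(cmod (f w))\<^sup>2 \<le> (sqrt n * S)\<^sup>2" by (intro power_mono) auto
      also have "\<dots> = S\<^sup>2 * n" using n by (simp add: power_mult_distrib)
      also have "\<dots> \<le> (S\<^sup>2 + 1) * n" using n by (intro mult_right_mono) auto
      finally have "ennreal ((cmod (f w))\<^sup>2) \<le> ennreal ((S\<^sup>2 + 1) * n)" by (rule ennreal_leI)
      also have "\<dots> = ennreal (S\<^sup>2 + 1) * ennreal n" using n by (intro ennreal_mult) auto
      finally show ?thesis using n by simp
    next
      case False
      then show ?thesis by (simp add: ennreal_mult_top not_less top_unique add_nonneg_pos)
    qed
  qed
qed

section \<open>Linear fractional self-maps of the disk\<close>

text \<open>Division by zero yields 0, a point of the disk, so the self-map hypothesis does not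
  directly exclude a pole inside. Away from the pole |a z + b| is below |c z + d|, and by continuity
  the weak inequality extends to the closed disk. A zero of the denominator would then be one of the
  numerator too, against the determinant.\<close>

lemma lin_frac_disk_closed:
  assumes det: "a * d - b * c \<noteq> 0" and self: "lin_frac a b c d ` unit_disk \<subseteq> unit_disk" and z: "cmod z \<le> 1"
  shows "c * z + d \<noteq> 0" "cmod (a * z + b) \<le> cmod (c * z + d)"
proof -
  define K where "K = {z. cmod (a * z + b) \<le> cmod (c * z + d)}"
  have "closed K" unfolding K_def by (intro closed_Collect_le continuous_intros)
  \<comment> \<open>The only candidate for a pole. For c = 0 this is the point 0, and deleting one
    point does not change the closure.\<close>
  define p where "p = - d / c"
  have sub: "unit_disk - {p} \<subseteq> K"
  proof
    fix z assume z: "z \<in> unit_disk - {p}"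
    have "c * z + d \<noteq> 0"
    proof
      assume *: "c * z + d = 0"
      then have "c \<noteq> 0" using det by auto
      moreover have "c * z = - d" using * by (simp add: eq_neg_iff_add_eq_0)
      ultimately have "z = p" using nonzero_mult_div_cancel_left[of c z] by (simp add: p_def)
      then show False using z by simp
    qed
    moreover have "cmod (lin_frac a b c d z) < 1" using self z by (auto simp: image_subset_iff)
    ultimately show "z \<in> K" by (simp add: K_def lin_frac_def norm_divide divide_simps)
  qed
  have "cball 0 1 \<subseteq> closure (unit_disk - {p})"
  proof -
    have "unit_disk \<subseteq> closure (unit_disk - {p})"
    proof
      fix x :: complex assume x: "x \<in> unit_disk"
      show "x \<in> closure (unit_disk - {p})"
      proof (cases "x = p")
        case True
        have "at p within unit_disk \<noteq> bot" using x True by (subst at_within_open) auto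
        then show ?thesis using True by (simp add: at_within_eq_bot_iff)
      next
        case False
        then have "x \<in> unit_disk - {p}" using x by simp
        then show ?thesis by (rule subsetD[OF closure_subset])
      qed
    qed
    then have "closure unit_disk \<subseteq> closure (unit_disk - {p})"
      by (intro closure_minimal) auto
    then show ?thesis by simp
  qed
  also have "\<dots> \<subseteq> K" using sub \<open>closed K\<close> by (rule closure_minimal)
  finally show le: "cmod (a * z + b) \<le> cmod (c * z + d)" using z by (auto simp: K_def)
  show "c * z + d \<noteq> 0"
  proof
    assume *: "c * z + d = 0"
    then have "a * z + b = 0" using le by simp
    moreover have "a * d - b * c = a * (c * z + d) - c * (a * z + b)" by (simp add: algebra_simps)
    ultimately show False using det * by simp
  qed
qed

lemma lin_frac_self_map_coeffs:
  assumes det: "a * d - b * c \<noteq> 0" and self: "lin_frac a b c d ` unit_disk \<subseteq> unit_disk"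
  shows "cmod c < cmod d" "cmod b < cmod d"
proof -
  have d: "d \<noteq> 0" using lin_frac_disk_closed(1)[OF assms, of 0] by simp
  show "cmod c < cmod d"
  proof (rule ccontr)
    assume "\<not> cmod c < cmod d"
    then have "c \<noteq> 0" "cmod (- d / c) \<le> 1" using d by (auto simp: norm_divide divide_simps)
    then show False using lin_frac_disk_closed(1)[OF assms, of "- d / c"] by simp
  qed
  have "lin_frac a b c d 0 \<in> unit_disk" using self by (auto simp: image_subset_iff)
  then show "cmod b < cmod d" using d by (simp add: lin_frac_def norm_divide)
qed

lemma affine_nonzero:
  fixes c d z :: complex
  assumes "cmod c < cmod d" "cmod z \<le> 1"
  shows "c * z + d \<noteq> 0"
proof
  assume "c * z + d = 0"
  then have "d = - (c * z)" by (simp add: eq_neg_iff_add_eq_0 add.commute)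
  then have "cmod d = cmod c * cmod z" by (simp add: norm_mult)
  also have "\<dots> \<le> cmod c" using assms(2) by (simp add: mult_left_le)
  finally show False using assms by simp
qed

text \<open>With denominators cleared, both sides are c z + d - (a z + b) conj(w).\<close>

lemma krein_identity:
  assumes "c * z + d \<noteq> 0" "- cnj b * w + cnj d \<noteq> 0"
  shows "(1 - lin_frac a b c d z * cnj w) * (c * z + d)
       = cnj (- cnj b * w + cnj d) * (1 - z * cnj (krein_adjoint a b c d w))"
proof -
  have "cnj (- cnj b * w + cnj d) \<noteq> 0" using assms(2) by (simp only: complex_cnj_zero_iff not_False_eq_True)
  then have "d - b * cnj w \<noteq> 0" by (simp add: algebra_simps)
  then show ?thesis using assms(1)
    by (simp add: lin_frac_def krein_adjoint_def field_simps)
qed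

text \<open>If |\<sigma>(w)| \<ge> 1, then z = 1/conj(\<sigma>(w)) lies in the closed disk and
  annihilates the right-hand side of the Krein identity. This yields \<phi>(z) conj(w) = 1,
  impossible for |\<phi>(z)| \<le> 1 and |w| < 1.\<close>

lemma krein_adjoint_self_map:
  assumes det: "a * d - b * c \<noteq> 0" and self: "lin_frac a b c d ` unit_disk \<subseteq> unit_disk" and w: "cmod w < 1"
  shows "cmod (krein_adjoint a b c d w) < 1"
proof (rule ccontr)
  assume n: "\<not> cmod (krein_adjoint a b c d w) < 1"
  define z where "z = 1 / cnj (krein_adjoint a b c d w)"
  have s0: "krein_adjoint a b c d w \<noteq> 0" using n by auto
  have z: "cmod z \<le> 1" using n by (simp add: z_def norm_divide divide_simps)
  note cz = lin_frac_disk_closed[OF det self z]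
  have nz: "- cnj b * w + cnj d \<noteq> 0"
    using affine_nonzero[of "- cnj b" "cnj d" w] lin_frac_self_map_coeffs[OF det self] w by simp
  have "(1 - lin_frac a b c d z * cnj w) * (c * z + d) = 0"
    unfolding krein_identity[OF cz(1) nz] using s0 by (simp add: z_def)
  then have "lin_frac a b c d z * cnj w = 1" using cz(1) by simp
  then have "cmod (lin_frac a b c d z) * cmod w = 1" by (metis complex_mod_cnj norm_mult norm_one)
  moreover have "cmod (lin_frac a b c d z) \<le> 1" using cz by (simp add: lin_frac_def norm_divide divide_simps)
  ultimately show False using w mult_right_mono[of "cmod (lin_frac a b c d z)" 1 "cmod w"] by simp
qed

text \<open>Read off from the Krein identity: w is taken in the direction of \<phi>(z), so that 1 -
  \<phi>(z) conj(w) is the real number 1 - t |\<phi>(z)|, and the remaining factors are bounded by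
  the coefficients and by 1 - |z|.\<close>

lemma lin_frac_schwarz_pick:
  assumes det: "a * d - b * c \<noteq> 0" and self: "lin_frac a b c d ` unit_disk \<subseteq> unit_disk"
  obtains K where "0 < K" "\<And>z. cmod z < 1 \<Longrightarrow> 1 - (cmod z)\<^sup>2 \<le> K * (1 - (cmod (lin_frac a b c d z))\<^sup>2)"
proof -
  note cd = lin_frac_self_map_coeffs[OF det self]
  \<comment> \<open>The numerator bounds |- conj(b) w + conj(d)| from below, the denominator bounds
    |c z + d| from above.\<close>
  define k where "k = (cmod d - cmod b) / (cmod c + cmod d)"
  have k: "0 < k" using cd by (auto simp: k_def intro!: divide_pos_pos add_nonneg_pos)
  have "1 - (cmod z)\<^sup>2 \<le> (2 / k) * (1 - (cmod (lin_frac a b c d z))\<^sup>2)" if z: "cmod z < 1" for z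
  proof -
    define x where "x = cmod (lin_frac a b c d z)"
    define u where "u = (if lin_frac a b c d z = 0 then 1 else sgn (lin_frac a b c d z))"
    have u: "cmod u = 1" by (simp add: u_def norm_sgn)
    have ux: "lin_frac a b c d z * cnj u = of_real x"
      by (auto simp: u_def x_def sgn_eq complex_norm_square[symmetric] power2_eq_square)
    have x1: "x < 1" using self z by (auto simp: image_subset_iff x_def)
    have *: "k * (1 - cmod z) \<le> 1 - t * x" if t: "0 < t" "t < 1" for t
    proof -
      define w where "w = of_real t * u"
      have w: "cmod w < 1" using t by (simp add: w_def norm_mult u)
      have nz: "- cnj b * w + cnj d \<noteq> 0"
        using affine_nonzero[of "- cnj b" "cnj d" w] cd w by simp
      have nz2: "c * z + d \<noteq> 0" using affine_nonzero[OF cd(1)] z by simp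
      have "cmod d - cmod b \<le> cmod (cnj d) - cmod (cnj b * w)"
        using w by (simp add: norm_mult mult_left_le)
      also have "\<dots> \<le> cmod (cnj d - cnj b * w)" by (rule norm_triangle_ineq2)
      finally have 1: "cmod d - cmod b \<le> cmod (- cnj b * w + cnj d)" by (simp add: algebra_simps)
      have "1 - cmod z \<le> 1 - cmod (z * cnj (krein_adjoint a b c d w))"
        using krein_adjoint_self_map[OF det self w] by (simp add: norm_mult mult_left_le)
      also have "\<dots> \<le> cmod (1 - z * cnj (krein_adjoint a b c d w))"
        using norm_triangle_ineq2[of 1 "z * cnj (krein_adjoint a b c d w)"] by simp
      finally have 2: "1 - cmod z \<le> cmod (1 - z * cnj (krein_adjoint a b c d w))" .
      have 3: "cmod (c * z + d) \<le> cmod c + cmod d"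
        using z by (intro order_trans[OF norm_triangle_ineq] add_mono) (auto simp: norm_mult mult_left_le)
      have "(cmod d - cmod b) * (1 - cmod z) \<le> cmod (- cnj b * w + cnj d) * cmod (1 - z * cnj (krein_adjoint a b c d w))"
        using cd z by (intro mult_mono 1 2) auto
      also have "\<dots> = cmod (1 - lin_frac a b c d z * cnj w) * cmod (c * z + d)"
        using arg_cong[OF krein_identity[OF nz2 nz, of a], of cmod] by (simp only: norm_mult complex_mod_cnj)
      also have "\<dots> \<le> cmod (1 - lin_frac a b c d z * cnj w) * (cmod c + cmod d)"
        by (intro mult_left_mono 3) auto
      also have "lin_frac a b c d z * cnj w = of_real (t * x)"
        using ux by (simp add: w_def mult_ac)
      also have "cmod (1 - of_real (t * x)) = 1 - t * x"
      proof -
        have "t * x \<le> 1" using t x1 by (intro mult_le_one) (auto simp: x_def)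
        then show ?thesis using norm_of_real[of "1 - t * x", where 'a=complex] by simp
      qed
      finally have "(cmod d - cmod b) * (1 - cmod z) \<le> (1 - t * x) * (cmod c + cmod d)" .
      moreover have "0 < cmod c + cmod d" using cd by (intro add_nonneg_pos) auto
      ultimately show ?thesis by (simp add: k_def pos_divide_le_eq)
    qed
    \<comment> \<open>The self-map property of \<sigma> covers |w| < 1 only, so t = 1 is reached as
      a limit.\<close>
    have "k * (1 - cmod z) \<le> 1 - 1 * x"
    proof (rule tendsto_lowerbound)
      show "((\<lambda>t. 1 - t * x) \<longlongrightarrow> 1 - 1 * x) (at_left 1)" by (intro tendsto_intros)
      show "\<forall>\<^sub>F t in at_left 1. k * (1 - cmod z) \<le> 1 - t * x"
        using * by (intro eventually_at_leftI[of 0]) auto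
    qed auto
    also have "\<dots> \<le> 1 - x\<^sup>2" using x1 by (simp add: power2_eq_square mult_left_le x_def)
    finally have le: "1 - cmod z \<le> (1 - x\<^sup>2) / k" using k by (simp add: field_simps)
    have "1 - (cmod z)\<^sup>2 \<le> 2 * (1 - cmod z)"
      using zero_le_power2[of "1 - cmod z"] unfolding power2_diff by simp
    also have "\<dots> \<le> 2 * ((1 - x\<^sup>2) / k)" by (intro mult_left_mono le) auto
    finally show ?thesis by (simp add: x_def)
  qed
  then show ?thesis using that[of "2 / k"] k by simp
qed

section \<open>Boundedness of weighted composition operators\<close>

lemma lin_frac_deriv:
  assumes "c * z + d \<noteq> 0"
  shows "(lin_frac a b c d has_field_derivative (a * d - b * c) / (c * z + d)\<^sup>2) (at z)"
  unfolding lin_frac_def using assms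
  by (auto intro!: derivative_eq_intros simp: field_simps power2_eq_square)

lemma lin_frac_inj_on:
  assumes "a * d - b * c \<noteq> 0" "\<And>z. z \<in> S \<Longrightarrow> c * z + d \<noteq> 0"
  shows "inj_on (lin_frac a b c d) S"
proof (rule inj_onI)
  fix x y assume xy: "x \<in> S" "y \<in> S" and "lin_frac a b c d x = lin_frac a b c d y"
  then have "(a * x + b) * (c * y + d) = (a * y + b) * (c * x + d)"
    using assms(2) by (simp add: lin_frac_def frac_eq_eq)
  then have "(a * d - b * c) * (x - y) = 0" by (simp add: algebra_simps)
  then show "x = y" using assms(1) by simp
qed

lemma disk_multiplier_bounded:
  assumes "h holomorphic_on ball 0 R" "1 < R"
  obtains H where "0 < H" "\<And>z. cmod z < 1 \<Longrightarrow> (cmod (h z))\<^sup>2 \<le> H"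
proof -
  have "compact (h ` cball 0 1)"
    using assms by (intro compact_continuous_image holomorphic_on_imp_continuous_on holomorphic_on_subset[OF assms(1)]) auto
  then obtain B where B: "0 < B" "\<And>z. cmod z \<le> 1 \<Longrightarrow> cmod (h z) \<le> B"
    by (auto dest!: compact_imp_bounded simp: bounded_pos)
  show ?thesis
  proof
    show "0 < B\<^sup>2" using B by simp
    show "(cmod (h z))\<^sup>2 \<le> B\<^sup>2" if "cmod z < 1" for z using B that by (intro power_mono) auto
  qed
qed

text \<open>Schwarz-Pick moves the weight from z to \<phi>(z), using \<alpha> \<ge> 0. The Jacobian
  |\<phi>'|^2 can be inserted because it is at least \<delta> > 0, and after substitution the
  integral runs over \<phi>(D), a part of the disk. This explains C = H K^\<alpha> /
  \<delta>.\<close>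

lemma disk_norm2_weighted_comp_le:
  assumes \<alpha>: "0 \<le> \<alpha>" and det: "a * d - b * c \<noteq> 0" and self: "lin_frac a b c d ` unit_disk \<subseteq> unit_disk"
    and h: "h holomorphic_on ball 0 R" "1 < R"
  obtains C where "0 < C"
    "\<And>f. f holomorphic_on unit_disk \<Longrightarrow> disk_norm2 \<alpha> (\<lambda>z. h z * f (lin_frac a b c d z)) \<le> ennreal C * disk_norm2 \<alpha> f"
proof -
  define \<phi> where "\<phi> = lin_frac a b c d"
  note cd = lin_frac_self_map_coeffs[OF det self]
  have nz: "c * z + d \<noteq> 0" if "cmod z < 1" for z using affine_nonzero[OF cd(1)] that by simp
  have der: "(\<phi> has_field_derivative (a * d - b * c) / (c * z + d)\<^sup>2) (at z)" if "cmod z < 1" for z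
    unfolding \<phi>_def using lin_frac_deriv[OF nz[OF that]] .
  have hol\<phi>: "\<phi> holomorphic_on unit_disk"
    using der by (auto simp: holomorphic_on_def field_differentiable_def intro!: exI DERIV_subset[OF der])
  have inj: "inj_on \<phi> unit_disk"
    unfolding \<phi>_def by (rule lin_frac_inj_on[OF det]) (use nz in auto)
  have self': "cmod (\<phi> z) < 1" if "cmod z < 1" for z
    using self that by (auto simp: \<phi>_def image_subset_iff)
  define \<delta> where "\<delta> = (cmod (a * d - b * c) / (cmod c + cmod d)\<^sup>2)\<^sup>2"
  have \<delta>0: "0 < \<delta>"
  proof -
    have "0 < cmod c + cmod d" using cd by (intro add_nonneg_pos) auto
    then show ?thesis using det by (simp add: \<delta>_def)
  qed
  have \<delta>: "\<delta> \<le> (cmod (deriv \<phi> z))\<^sup>2" if z: "cmod z < 1" for z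
  proof -
    have "cmod (c * z + d) \<le> cmod c + cmod d"
      using z by (intro order_trans[OF norm_triangle_ineq] add_mono) (auto simp: norm_mult mult_left_le)
    then have "(cmod (c * z + d))\<^sup>2 \<le> (cmod c + cmod d)\<^sup>2" by (intro power_mono) auto
    moreover have "0 < (cmod (c * z + d))\<^sup>2" using nz[OF z] by simp
    ultimately have "cmod (a * d - b * c) / (cmod c + cmod d)\<^sup>2 \<le> cmod (a * d - b * c) / (cmod (c * z + d))\<^sup>2"
      by (intro divide_left_mono mult_pos_pos) (use cd in \<open>auto intro: add_nonneg_pos\<close>)
    also have "\<dots> = cmod (deriv \<phi> z)"
      using DERIV_imp_deriv[OF der[OF z]] by (simp add: norm_divide norm_power)
    finally show ?thesis unfolding \<delta>_def by (intro power_mono) auto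
  qed
  obtain K where K: "0 < K" "\<And>z. cmod z < 1 \<Longrightarrow> 1 - (cmod z)\<^sup>2 \<le> K * (1 - (cmod (\<phi> z))\<^sup>2)"
    using lin_frac_schwarz_pick[OF det self] unfolding \<phi>_def by blast
  obtain H where H: "0 < H" "\<And>z. cmod z < 1 \<Longrightarrow> (cmod (h z))\<^sup>2 \<le> H"
    using disk_multiplier_bounded[OF h] by blast
  define C where "C = H * K powr \<alpha> / \<delta>"
  have C: "0 < C" using H K \<delta>0 by (simp add: C_def)
  show ?thesis
  proof
    show "0 < C" by fact
    fix f assume f: "f holomorphic_on unit_disk"
    define F where "F z = indicator unit_disk z * ((cmod (f z))\<^sup>2 * (1 - (cmod z)\<^sup>2) powr \<alpha>)" for z
    have [measurable]: "(\<lambda>z. indicator unit_disk z *\<^sub>R f z) \<in> borel_measurable borel"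
      by (rule borel_measurable_continuous_on_indicator[OF _ holomorphic_on_imp_continuous_on[OF f]]) auto
    have F: "F \<in> borel_measurable borel"
    proof -
      have "F = (\<lambda>z. indicator unit_disk z * ((cmod (indicator unit_disk z *\<^sub>R f z))\<^sup>2 * (1 - (cmod z)\<^sup>2) powr \<alpha>))"
        by (auto simp: F_def indicator_def)
      also have "\<dots> \<in> borel_measurable borel" by measurable
      finally show ?thesis .
    qed
    have F0: "0 \<le> F z" for z by (simp add: F_def)
    have pw: "indicator unit_disk z * ((cmod (h z * f (\<phi> z)))\<^sup>2 * (1 - (cmod z)\<^sup>2) powr \<alpha>)
        \<le> C * (indicator unit_disk z * ((cmod (deriv \<phi> z))\<^sup>2 * F (\<phi> z)))" for z
    proof (cases "cmod z < 1")
      case True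
      have "0 \<le> 1 - (cmod z)\<^sup>2" using True by (simp add: power_le_one)
      then have p: "(1 - (cmod z)\<^sup>2) powr \<alpha> \<le> K powr \<alpha> * (1 - (cmod (\<phi> z))\<^sup>2) powr \<alpha>"
        using powr_mono2[OF \<alpha> _ K(2)[OF True]] K(1) self'[OF True] by (simp add: powr_mult power_le_one)
      have "(cmod (h z * f (\<phi> z)))\<^sup>2 * (1 - (cmod z)\<^sup>2) powr \<alpha> = (cmod (h z))\<^sup>2 * (cmod (f (\<phi> z)))\<^sup>2 * (1 - (cmod z)\<^sup>2) powr \<alpha>"
        by (simp add: norm_mult power_mult_distrib)
      also have "\<dots> \<le> H * (cmod (f (\<phi> z)))\<^sup>2 * (K powr \<alpha> * (1 - (cmod (\<phi> z))\<^sup>2) powr \<alpha>)"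
        using H True by (intro mult_mono p) auto
      also have "\<dots> = C * (\<delta> * F (\<phi> z))"
        using self'[OF True] \<delta>0 by (simp add: C_def F_def mult_ac)
      also have "\<dots> \<le> C * ((cmod (deriv \<phi> z))\<^sup>2 * F (\<phi> z))"
        using C \<delta>[OF True] F0 by (intro mult_left_mono mult_right_mono) auto
      finally show ?thesis using True by simp
    qed simp
    have "disk_norm2 \<alpha> (\<lambda>z. h z * f (\<phi> z)) \<le> (\<integral>\<^sup>+z. ennreal C * ennreal (indicator unit_disk z * ((cmod (deriv \<phi> z))\<^sup>2 * F (\<phi> z))) \<partial>lborel)"
      unfolding disk_norm2_def
      by (intro nn_integral_mono) (use pw C in \<open>simp add: ennreal_mult'[symmetric] ennreal_leI\<close>)
    also have "\<dots> = ennreal C * (\<integral>\<^sup>+z. ennreal (indicator unit_disk z * ((cmod (deriv \<phi> z))\<^sup>2 * F (\<phi> z))) \<partial>lborel)"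
    proof (rule nn_integral_cmult)
      have c1: "continuous_on unit_disk (deriv \<phi>)"
        by (intro holomorphic_on_imp_continuous_on holomorphic_deriv hol\<phi>) auto
      have [measurable]: "(\<lambda>z. indicator unit_disk z *\<^sub>R deriv \<phi> z) \<in> borel_measurable borel"
        "(\<lambda>z. indicator unit_disk z *\<^sub>R \<phi> z) \<in> borel_measurable borel"
        using borel_measurable_continuous_on_indicator[OF _ c1]
          borel_measurable_continuous_on_indicator[OF _ holomorphic_on_imp_continuous_on[OF hol\<phi>]] by auto
      note F [measurable]
      have "(\<lambda>z. ennreal (indicator unit_disk z * ((cmod (indicator unit_disk z *\<^sub>R deriv \<phi> z))\<^sup>2 * F (indicator unit_disk z *\<^sub>R \<phi> z)))) \<in> borel_measurable borel"
        by measurable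
      also have "(\<lambda>z. ennreal (indicator unit_disk z * ((cmod (indicator unit_disk z *\<^sub>R deriv \<phi> z))\<^sup>2 * F (indicator unit_disk z *\<^sub>R \<phi> z)))) =
         (\<lambda>z. ennreal (indicator unit_disk z * ((cmod (deriv \<phi> z))\<^sup>2 * F (\<phi> z))))"
        by (auto simp: indicator_def)
      finally show "(\<lambda>z. ennreal (indicator unit_disk z * ((cmod (deriv \<phi> z))\<^sup>2 * F (\<phi> z)))) \<in> borel_measurable lborel" by simp
    qed
    also have "\<dots> = ennreal C * (\<integral>\<^sup>+z. ennreal (indicator (\<phi> ` unit_disk) z * F z) \<partial>lborel)"
      using nn_integral_holomorphic_change_of_variables[OF _ hol\<phi> inj F F0] by simp
    also have "\<dots> \<le> ennreal C * disk_norm2 \<alpha> f"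
      unfolding disk_norm2_def
      by (intro mult_left_mono nn_integral_mono ennreal_leI) (auto simp: F_def indicator_def)
    finally show "disk_norm2 \<alpha> (\<lambda>z. h z * f (lin_frac a b c d z)) \<le> ennreal C * disk_norm2 \<alpha> f"
      unfolding \<phi>_def .
  qed
qed

text \<open>Differentiation turns the weight \<open>\<alpha>\<close> into \<open>\<alpha> + 2\<close>, which reduces every real \<open>\<alpha>\<close> to the
  case \<open>\<alpha> \<ge> 0\<close>, where the norm is an integral and a change of variables applies.\<close>

lemma weighted_norm2_weighted_comp_le:
  assumes det: "a * d - b * c \<noteq> 0" and self: "lin_frac a b c d ` unit_disk \<subseteq> unit_disk"
    and h: "h holomorphic_on ball 0 R" "1 < R"
  shows "\<exists>C>0. \<forall>f. f holomorphic_on unit_disk \<longrightarrow>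
     weighted_norm2 \<alpha> (\<lambda>z. h z * f (lin_frac a b c d z)) \<le> ennreal C * weighted_norm2 \<alpha> f"
proof -
  define \<phi> where "\<phi> = lin_frac a b c d"
  note cd = lin_frac_self_map_coeffs[OF det self]
  have self': "cmod (\<phi> z) < 1" if "cmod z < 1" for z
    using self that by (auto simp: \<phi>_def image_subset_iff)
  \<comment> \<open>The next level uses h \<phi>' as a multiplier, so \<phi> too must be holomorphic
    beyond the closed disk.\<close>
  obtain R' where R': "1 < R'" "\<And>z. cmod z < R' \<Longrightarrow> c * z + d \<noteq> 0"
  proof (cases "c = 0")
    case True
    then show ?thesis using that[of 2] cd by auto
  next
    case False
    have "c * z + d \<noteq> 0" if "cmod z < cmod d / cmod c" for z
    proof
      assume "c * z + d = 0"
      then have "d = - (c * z)" by (simp add: eq_neg_iff_add_eq_0 add.commute)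
      then have "cmod d = cmod c * cmod z" by (simp add: norm_mult)
      then show False using that False by simp
    qed
    then show ?thesis using that[of "cmod d / cmod c"] cd False by simp
  qed
  have hol\<phi>: "\<phi> holomorphic_on ball 0 R'"
    unfolding \<phi>_def lin_frac_def using R' by (intro holomorphic_intros) auto
  have hol\<phi>1: "\<phi> holomorphic_on unit_disk"
    using R'(1) by (intro holomorphic_on_subset[OF hol\<phi>]) auto
  \<comment> \<open>Here n counts the derivatives that lift \<alpha> to a nonnegative weight. The
    claim is general in \<alpha>, h and R because the induction step applies it at \<alpha> + 2 to
    the multipliers h' and h \<phi>'.\<close>
  have main: "\<And>\<alpha> h R. - 2 * real n \<le> \<alpha> \<Longrightarrow> 1 < R \<Longrightarrow> h holomorphic_on ball 0 R \<Longrightarrow>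
    \<exists>C>0. \<forall>f. f holomorphic_on unit_disk \<longrightarrow> weighted_norm2 \<alpha> (\<lambda>z. h z * f (\<phi> z)) \<le> ennreal C * weighted_norm2 \<alpha> f" for n
  proof (induction n)
    case 0
    obtain C where C: "0 < C" "\<And>f. f holomorphic_on unit_disk \<Longrightarrow> disk_norm2 \<alpha> (\<lambda>z. h z * f (\<phi> z)) \<le> ennreal C * disk_norm2 \<alpha> f"
      using disk_norm2_weighted_comp_le[OF _ det self 0(3) 0(2), of \<alpha>] 0(1) unfolding \<phi>_def by auto
    obtain c' C' where c': "0 < c'" "0 < C'"
      "\<And>f. f holomorphic_on unit_disk \<Longrightarrow> weighted_norm2 \<alpha> f \<le> ennreal c' * disk_norm2 \<alpha> f"
      "\<And>f. f holomorphic_on unit_disk \<Longrightarrow> disk_norm2 \<alpha> f \<le> ennreal C' * weighted_norm2 \<alpha> f"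
      using disk_norm2_comparable[of \<alpha>] 0(1) by auto
    have h1: "h holomorphic_on unit_disk" using 0 by (intro holomorphic_on_subset[OF 0(3)]) auto
    have "weighted_norm2 \<alpha> (\<lambda>z. h z * f (\<phi> z)) \<le> ennreal (c' * (C * C')) * weighted_norm2 \<alpha> f" if f: "f holomorphic_on unit_disk" for f
    proof -
      have u: "(\<lambda>z. h z * f (\<phi> z)) holomorphic_on unit_disk"
        using self' by (intro holomorphic_on_mult h1 holomorphic_on_compose_gen[OF hol\<phi>1 f, unfolded o_def]) auto
      have "weighted_norm2 \<alpha> (\<lambda>z. h z * f (\<phi> z)) \<le> ennreal c' * (ennreal C * (ennreal C' * weighted_norm2 \<alpha> f))"
        by (rule order_trans[OF c'(3)[OF u]] mult_left_mono order_trans[OF C(2)[OF f]] c'(4)[OF f] zero_le)+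
      then show ?thesis using C c' by (simp add: ennreal_mult mult.assoc)
    qed
    moreover have "0 < c' * (C * C')" using C c' by simp
    ultimately show ?case by blast
  next
    case (Suc n)
    have \<alpha>2: "- 2 * real n \<le> \<alpha> + 2" using Suc.prems(1) by simp
    have dh: "deriv h holomorphic_on ball 0 R" using Suc.prems by (intro holomorphic_deriv) auto
    define S where "S = min R R'"
    have S: "1 < S" using R' Suc.prems by (simp add: S_def)
    have hp: "(\<lambda>z. h z * deriv \<phi> z) holomorphic_on ball 0 S"
      by (intro holomorphic_intros holomorphic_on_subset[OF Suc.prems(3)] holomorphic_on_subset[OF hol\<phi>])
        (auto simp: S_def)
    obtain C1 where C1: "0 < C1" "\<And>f. f holomorphic_on unit_disk \<Longrightarrow> weighted_norm2 (\<alpha> + 2) (\<lambda>z. deriv h z * f (\<phi> z)) \<le> ennreal C1 * weighted_norm2 (\<alpha> + 2) f"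
      using Suc.IH[OF \<alpha>2 Suc.prems(2) dh] by blast
    obtain C2 where C2: "0 < C2" "\<And>f. f holomorphic_on unit_disk \<Longrightarrow> weighted_norm2 (\<alpha> + 2) (\<lambda>z. h z * deriv \<phi> z * f (\<phi> z)) \<le> ennreal C2 * weighted_norm2 (\<alpha> + 2) f"
      using Suc.IH[OF \<alpha>2 S hp] by blast
    obtain P where P: "0 < P" "\<And>f. f holomorphic_on unit_disk \<Longrightarrow> ennreal ((cmod (f (\<phi> 0)))\<^sup>2) \<le> ennreal P * weighted_norm2 \<alpha> f"
      using point_evaluation_bounded[of "\<phi> 0" \<alpha>] self'[of 0] by auto
    define k where "k = 2 powr \<bar>\<alpha> + 1\<bar>"
    have k: "0 < k" by (simp add: k_def)
    \<comment> \<open>The summands come from the value h(0) f(\<phi>(0)), from h' (f o \<phi>) and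
      from h \<phi>' (f' o \<phi>). The factors 2 come from squaring a sum, and k is the cost of one
      differentiation.\<close>
    define C where "C = (cmod (h 0))\<^sup>2 * P + k * (2 * C1 + 2 * (C2 * k))"
    have h1: "h holomorphic_on unit_disk" using Suc.prems by (intro holomorphic_on_subset[OF Suc.prems(3)]) auto
    have bound: "weighted_norm2 \<alpha> (\<lambda>z. h z * f (\<phi> z)) \<le> ennreal C * weighted_norm2 \<alpha> f" if f: "f holomorphic_on unit_disk" for f
    proof -
      define N where "N = weighted_norm2 \<alpha> f"
      have df: "deriv f holomorphic_on unit_disk" using f by (intro holomorphic_deriv) auto
      have comp: "(\<lambda>z. u (\<phi> z)) holomorphic_on unit_disk" if "u holomorphic_on unit_disk" for u
        using self' by (intro holomorphic_on_compose_gen[OF hol\<phi>1 that, unfolded o_def]) auto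
      have der: "deriv (\<lambda>z. h z * f (\<phi> z)) z = deriv h z * f (\<phi> z) + h z * deriv \<phi> z * deriv f (\<phi> z)" if z: "cmod z < 1" for z
      proof (rule DERIV_imp_deriv)
        have "(h has_field_derivative deriv h z) (at z)" using h1 z by (intro holomorphic_derivI[of _ unit_disk]) auto
        moreover have "(\<phi> has_field_derivative deriv \<phi> z) (at z)" using hol\<phi>1 z by (intro holomorphic_derivI[of _ unit_disk]) auto
        moreover have "(f has_field_derivative deriv f (\<phi> z)) (at (\<phi> z))" using f self'[OF z] by (intro holomorphic_derivI[of _ unit_disk]) auto
        ultimately show "((\<lambda>z. h z * f (\<phi> z)) has_field_derivative deriv h z * f (\<phi> z) + h z * deriv \<phi> z * deriv f (\<phi> z)) (at z)"
          by (auto intro!: derivative_eq_intros DERIV_chain2[of f] simp: algebra_simps)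
      qed
      \<comment> \<open>This term still contains f itself, but the norm at \<alpha> + 2 is weaker
        than the one at \<alpha>.\<close>
      have n1: "weighted_norm2 (\<alpha> + 2) (\<lambda>z. deriv h z * f (\<phi> z)) \<le> ennreal C1 * N"
        unfolding N_def by (rule order_trans[OF C1(2)[OF f] mult_left_mono[OF weighted_norm2_antimono]]) auto
      have n2: "weighted_norm2 (\<alpha> + 2) (\<lambda>z. h z * deriv \<phi> z * deriv f (\<phi> z)) \<le> ennreal C2 * (ennreal k * N)"
        unfolding N_def k_def by (rule order_trans[OF C2(2)[OF df] mult_left_mono[OF weighted_norm2_deriv_le]]) auto
      have "weighted_norm2 (\<alpha> + 2) (deriv (\<lambda>z. h z * f (\<phi> z)))
          = weighted_norm2 (\<alpha> + 2) (\<lambda>z. deriv h z * f (\<phi> z) + h z * deriv \<phi> z * deriv f (\<phi> z))"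
        by (rule weighted_norm2_cong) (rule der)
      also have "\<dots> \<le> 2 * weighted_norm2 (\<alpha> + 2) (\<lambda>z. deriv h z * f (\<phi> z)) + 2 * weighted_norm2 (\<alpha> + 2) (\<lambda>z. h z * deriv \<phi> z * deriv f (\<phi> z))"
        using R' Suc.prems
        by (intro weighted_norm2_add_le holomorphic_on_mult comp f df h1 holomorphic_deriv hol\<phi>1) auto
      also have "\<dots> \<le> 2 * (ennreal C1 * N) + 2 * (ennreal C2 * (ennreal k * N))"
        by (intro add_mono mult_left_mono n1 n2) auto
      finally have n3: "weighted_norm2 (\<alpha> + 2) (deriv (\<lambda>z. h z * f (\<phi> z))) \<le> 2 * (ennreal C1 * N) + 2 * (ennreal C2 * (ennreal k * N))" .
      have n0: "ennreal ((cmod (h 0 * f (\<phi> 0)))\<^sup>2) \<le> ennreal ((cmod (h 0))\<^sup>2) * (ennreal P * N)"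
        unfolding N_def norm_mult power_mult_distrib using mult_left_mono[OF P(2)[OF f], of "ennreal ((cmod (h 0))\<^sup>2)"]
        by (simp add: ennreal_mult)
      have "weighted_norm2 \<alpha> (\<lambda>z. h z * f (\<phi> z)) \<le> ennreal ((cmod (h 0 * f (\<phi> 0)))\<^sup>2) + ennreal k * weighted_norm2 (\<alpha> + 2) (deriv (\<lambda>z. h z * f (\<phi> z)))"
        unfolding k_def by (rule weighted_norm2_le_deriv)
      also have "\<dots> \<le> ennreal ((cmod (h 0))\<^sup>2) * (ennreal P * N) + ennreal k * (2 * (ennreal C1 * N) + 2 * (ennreal C2 * (ennreal k * N)))"
        by (intro add_mono mult_left_mono n0 n3) auto
      also have "\<dots> = ennreal C * N"
        using P C1 C2 k by (simp add: C_def ennreal_mult distrib_left distrib_right mult_ac)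
      finally show ?thesis by (simp add: N_def)
    qed
    have "0 < C" unfolding C_def using P C1 C2 k by (intro add_nonneg_pos mult_pos_pos add_pos_pos) auto
    then show ?case using bound by blast
  qed
  obtain n :: nat where "- \<alpha> / 2 \<le> real n" using real_arch_simple by blast
  then have "- 2 * real n \<le> \<alpha>" by simp
  from main[OF this h(2) h(1)] show ?thesis unfolding \<phi>_def .
qed

section \<open>The reproducing kernel Hilbert space and adjoints\<close>

lemma taylor_coeff_eqI:
  assumes "\<And>x. cmod x < 1 \<Longrightarrow> (\<lambda>m. a m * x ^ m) sums f x"
  shows "taylor_coeff f m = a m"
proof -
  have "f has_fps_expansion Abs_fps a"
    by (rule has_fps_expansionI, rule eventually_mono[OF eventually_nhds_in_open[of unit_disk]])
      (use assms in auto)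
  then show ?thesis using fps_nth_fps_expansion by (fastforce simp: taylor_coeff_def)
qed

text \<open>The binomial series for the exponent - (\<alpha> + 2): the sign of the binomial
  coefficient cancels that of (-x)^m.\<close>

lemma kernel_profile_sums:
  assumes "cmod x < 1"
  shows "(\<lambda>m. ((-1) ^ N * of_real (pochhammer (\<alpha> + 2) m / fact m) + coeff Q m) * x ^ m) sums kernel_profile \<alpha> N Q x"
proof -
  have "(\<lambda>m. (- (complex_of_real \<alpha> + 2) gchoose m) * (- x) ^ m) sums (1 + - x) powr (- (complex_of_real \<alpha> + 2))"
    using assms by (intro gen_binomial_complex) simp
  moreover have "(- (complex_of_real \<alpha> + 2) gchoose m) * (- x) ^ m = of_real (pochhammer (\<alpha> + 2) m / fact m) * x ^ m" for m
  proof -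
    have "pochhammer (complex_of_real \<alpha> + 2) m = of_real (pochhammer (\<alpha> + 2) m)"
      by (simp flip: pochhammer_of_real)
    then have "(- (complex_of_real \<alpha> + 2) gchoose m) = (-1) ^ m * (of_real (pochhammer (\<alpha> + 2) m) / fact m)"
      unfolding gbinomial_pochhammer minus_minus by simp
    moreover have "(- x) ^ m = (-1) ^ m * x ^ m" by (rule power_minus)
    ultimately have "(- (complex_of_real \<alpha> + 2) gchoose m) * (- x) ^ m
        = ((-1) ^ m * (-1) ^ m) * (of_real (pochhammer (\<alpha> + 2) m) / fact m * x ^ m)"
      by (simp only: mult_ac)
    then show ?thesis by (simp only: power_mult_distrib[symmetric]) simp
  qed
  ultimately have 1: "(\<lambda>m. of_real (pochhammer (\<alpha> + 2) m / fact m) * x ^ m) sums (1 - x) powr (- (complex_of_real \<alpha> + 2))"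
    by simp
  have 2: "(\<lambda>m. coeff Q m * x ^ m) sums poly Q x"
    unfolding poly_altdef by (rule sums_finite) (auto simp: coeff_eq_0)
  show ?thesis
    using sums_add[OF sums_mult[OF 1, of "(-1) ^ N"] 2] by (simp add: kernel_profile_def algebra_simps)
qed

lemma taylor_coeff_kernel_profile:
  "taylor_coeff (kernel_profile \<alpha> N Q) m = (-1) ^ N * of_real (pochhammer (\<alpha> + 2) m / fact m) + coeff Q m"
  by (rule taylor_coeff_eqI) (rule kernel_profile_sums)

lemma ennreal_le_cmult_finite:
  assumes "x \<le> ennreal c * y" "y < \<infinity>"
  shows "x < \<infinity>"
  by (rule le_less_trans[OF assms(1)]) (use assms(2) in \<open>simp add: ennreal_mult_less_top\<close>)

locale A2_space =
  fixes \<alpha> :: real and N :: nat and Q :: "complex poly"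
  assumes not_pole: "\<alpha> + 2 \<notin> \<int>\<^sub>\<le>\<^sub>0" and data: "kernel_data \<alpha> N Q"
begin

text \<open>The kernel coefficients as real numbers; 1/\<kappa> m is the squared norm of
  z^m.\<close>

definition \<kappa> :: "nat \<Rightarrow> real" where
  "\<kappa> m = Re (taylor_coeff (kernel_profile \<alpha> N Q) m)"

lemma kernel_coeff: "taylor_coeff (kernel_profile \<alpha> N Q) m = of_real (\<kappa> m)"
  and \<kappa>_pos: "0 < \<kappa> m"
proof -
  have "\<exists>r>0. taylor_coeff (kernel_profile \<alpha> N Q) m = of_real r"
    using data unfolding kernel_data_def
  proof (elim disjE conjE)
    assume "\<alpha> + 2 > 0" "N = 0" "Q = 0"
    then show ?thesis
      by (intro exI[of _ "pochhammer (\<alpha> + 2) m / fact m"]) (auto simp: taylor_coeff_kernel_profile pochhammer_pos)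
  qed auto
  then show "taylor_coeff (kernel_profile \<alpha> N Q) m = of_real (\<kappa> m)" "0 < \<kappa> m"
    by (auto simp: \<kappa>_def)
qed

lemma kernel_sums:
  assumes "cmod x < 1"
  shows "(\<lambda>m. of_real (\<kappa> m) * x ^ m) sums kernel_profile \<alpha> N Q x"
  using kernel_profile_sums[OF assms, of N \<alpha> Q] unfolding taylor_coeff_kernel_profile[symmetric] kernel_coeff .

text \<open>Beyond the degree of \<open>Q\<close> the coefficient is, up to sign, that of the pure
  power. Its limit constant |1/Gamma(\<alpha> + 2)| is nonzero because \<alpha> + 2 is not a pole of
  Gamma.\<close>

lemma \<kappa>_comparable:
  obtains c C where "0 < c" "0 < C" "\<And>n. c * (real n + 1) powr (\<alpha> + 1) \<le> \<kappa> n" "\<And>n. \<kappa> n \<le> C * (real n + 1) powr (\<alpha> + 1)"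
proof (rule tendsto_ratio_imp_comparable)
  have "(\<lambda>m. \<bar>pochhammer (\<alpha> + 2) m / fact m / (real m + 1) powr (\<alpha> + 2 - 1)\<bar>) \<longlonglongrightarrow> \<bar>rGamma (\<alpha> + 2)\<bar>"
    by (intro tendsto_rabs pochhammer_div_fact_asymp)
  moreover have "eventually (\<lambda>m. \<bar>pochhammer (\<alpha> + 2) m / fact m / (real m + 1) powr (\<alpha> + 2 - 1)\<bar> = \<kappa> m / (real m + 1) powr (\<alpha> + 1)) sequentially"
    using eventually_gt_at_top[of "degree Q"]
  proof eventually_elim
    case (elim m)
    have "complex_of_real (\<kappa> m) = (-1) ^ N * of_real (pochhammer (\<alpha> + 2) m / fact m)"
      using elim kernel_coeff[of m] by (simp add: taylor_coeff_kernel_profile coeff_eq_0)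
    then have "cmod (complex_of_real (\<kappa> m)) = cmod ((-1) ^ N * of_real (pochhammer (\<alpha> + 2) m / fact m))" by simp
    then have "\<kappa> m = \<bar>pochhammer (\<alpha> + 2) m / fact m\<bar>"
      unfolding norm_mult norm_of_real norm_power using \<kappa>_pos[of m] by simp
    then show ?case by (simp add: abs_divide add.commute[of \<alpha>])
  qed
  ultimately show "(\<lambda>m. \<kappa> m / (real m + 1) powr (\<alpha> + 1)) \<longlonglongrightarrow> \<bar>rGamma (\<alpha> + 2)\<bar>"
    by (rule Lim_transform_eventually)
  show "0 < \<bar>rGamma (\<alpha> + 2)\<bar>" using not_pole by (simp add: rGamma_eq_zero_iff)
qed (use \<kappa>_pos that in auto)

section \<open>The norm and inner product determined by the kernel coefficients\<close>

definition knorm2 :: "(complex \<Rightarrow> complex) \<Rightarrow> real" where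
  "knorm2 f = (\<Sum>m. (cmod (taylor_coeff f m))\<^sup>2 / \<kappa> m)"

abbreviation ip :: "(complex \<Rightarrow> complex) \<Rightarrow> (complex \<Rightarrow> complex) \<Rightarrow> complex" where
  "ip \<equiv> A2_inner \<alpha> N Q"

lemma ip_def: "ip f g = (\<Sum>m. taylor_coeff f m * cnj (taylor_coeff g m) / of_real (\<kappa> m))"
  by (simp add: A2_inner_def kernel_coeff)

lemma weighted_norm2_kernel_comparable:
  obtains c C where "0 < c" "0 < C"
    "\<And>f. weighted_norm2 \<alpha> f \<le> ennreal c * (\<Sum>m. ennreal ((cmod (taylor_coeff f m))\<^sup>2 / \<kappa> m))"
    "\<And>f. (\<Sum>m. ennreal ((cmod (taylor_coeff f m))\<^sup>2 / \<kappa> m)) \<le> ennreal C * weighted_norm2 \<alpha> f"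
proof -
  obtain c C where cC: "0 < c" "0 < C" "\<And>n. c * (real n + 1) powr (\<alpha> + 1) \<le> \<kappa> n" "\<And>n. \<kappa> n \<le> C * (real n + 1) powr (\<alpha> + 1)"
    using that by (rule \<kappa>_comparable)
  have 1: "(real n + 1) powr (- (\<alpha> + 1)) \<le> C * (1 / \<kappa> n)" for n
    using cC(4)[of n] \<kappa>_pos[of n] unfolding powr_minus by (simp add: divide_simps)
  have 2: "1 / \<kappa> n \<le> inverse c * (real n + 1) powr (- (\<alpha> + 1))" for n
    using cC(3)[of n] cC(1) \<kappa>_pos[of n] unfolding powr_minus by (simp add: divide_simps mult.commute)
  show ?thesis
  proof
    show "0 < C" "0 < inverse c" using cC by auto
    show "weighted_norm2 \<alpha> f \<le> ennreal C * (\<Sum>m. ennreal ((cmod (taylor_coeff f m))\<^sup>2 / \<kappa> m))" for f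
      unfolding weighted_norm2_def divide_inverse
      by (rule suminf_ennreal_weight_mono) (use 1 cC \<kappa>_pos in \<open>auto simp: divide_inverse less_imp_le\<close>)
    show "(\<Sum>m. ennreal ((cmod (taylor_coeff f m))\<^sup>2 / \<kappa> m)) \<le> ennreal (inverse c) * weighted_norm2 \<alpha> f" for f
      unfolding weighted_norm2_def divide_inverse
      by (rule suminf_ennreal_weight_mono) (use 2 cC \<kappa>_pos in \<open>auto simp: divide_inverse less_imp_le\<close>)
  qed
qed

lemma weighted_norm2_finite_iff:
  "weighted_norm2 \<alpha> f < \<infinity> \<longleftrightarrow> summable (\<lambda>m. (cmod (taylor_coeff f m))\<^sup>2 / \<kappa> m)"
proof -
  obtain c C where "0 < c" "0 < C" and cC:
    "\<And>f. weighted_norm2 \<alpha> f \<le> ennreal c * (\<Sum>m. ennreal ((cmod (taylor_coeff f m))\<^sup>2 / \<kappa> m))"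
    "\<And>f. (\<Sum>m. ennreal ((cmod (taylor_coeff f m))\<^sup>2 / \<kappa> m)) \<le> ennreal C * weighted_norm2 \<alpha> f"
    using that by (rule weighted_norm2_kernel_comparable)
  from cC[of f] have "weighted_norm2 \<alpha> f < \<infinity> \<longleftrightarrow> (\<Sum>m. ennreal ((cmod (taylor_coeff f m))\<^sup>2 / \<kappa> m)) < \<infinity>"
    using ennreal_le_cmult_finite by blast
  also have "\<dots> \<longleftrightarrow> summable (\<lambda>m. (cmod (taylor_coeff f m))\<^sup>2 / \<kappa> m)"
  proof
    assume "(\<Sum>m. ennreal ((cmod (taylor_coeff f m))\<^sup>2 / \<kappa> m)) < \<infinity>"
    then have "(\<Sum>m. ennreal ((cmod (taylor_coeff f m))\<^sup>2 / \<kappa> m)) \<noteq> top" by simp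
    then show "summable (\<lambda>m. (cmod (taylor_coeff f m))\<^sup>2 / \<kappa> m)"
      using \<kappa>_pos less_imp_le by (intro summable_suminf_not_top divide_nonneg_pos) auto
  next
    assume "summable (\<lambda>m. (cmod (taylor_coeff f m))\<^sup>2 / \<kappa> m)"
    then show "(\<Sum>m. ennreal ((cmod (taylor_coeff f m))\<^sup>2 / \<kappa> m)) < \<infinity>"
      by (subst suminf_ennreal2) (auto simp: less_imp_le[OF \<kappa>_pos])
  qed
  finally show ?thesis .
qed

lemma A2_iff_summable:
  "f \<in> A2 \<alpha> \<longleftrightarrow> f holomorphic_on unit_disk \<and> (\<forall>z. z \<notin> unit_disk \<longrightarrow> f z = 0) \<and>
     summable (\<lambda>m. (cmod (taylor_coeff f m))\<^sup>2 / \<kappa> m)"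
  unfolding A2_iff weighted_norm2_finite_iff ..

lemma A2_holomorphic: "f \<in> A2 \<alpha> \<Longrightarrow> f holomorphic_on unit_disk"
  and A2_off: "f \<in> A2 \<alpha> \<Longrightarrow> \<not> cmod z < 1 \<Longrightarrow> f z = 0"
  and A2_summable: "f \<in> A2 \<alpha> \<Longrightarrow> summable (\<lambda>m. (cmod (taylor_coeff f m))\<^sup>2 / \<kappa> m)"
  by (auto simp: A2_iff_summable)

lemma knorm2_nonneg: "f \<in> A2 \<alpha> \<Longrightarrow> 0 \<le> knorm2 f"
  unfolding knorm2_def by (intro suminf_nonneg A2_summable) (auto simp: less_imp_le[OF \<kappa>_pos])

lemma partial_knorm2_le:
  assumes "f \<in> A2 \<alpha>"
  shows "(\<Sum>m<n. (cmod (taylor_coeff f m))\<^sup>2 / \<kappa> m) \<le> knorm2 f"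
  unfolding knorm2_def by (intro sum_le_suminf A2_summable assms) (auto simp: less_imp_le[OF \<kappa>_pos])

lemma bounded_on_A2:
  assumes "\<And>u. u \<in> A2 \<alpha> \<Longrightarrow> T u holomorphic_on unit_disk" "\<And>u z. u \<in> A2 \<alpha> \<Longrightarrow> \<not> cmod z < 1 \<Longrightarrow> T u z = 0"
    "\<And>u. u \<in> A2 \<alpha> \<Longrightarrow> weighted_norm2 \<alpha> (T u) \<le> ennreal K * weighted_norm2 \<alpha> u"
  shows "\<exists>C\<ge>0. \<forall>u\<in>A2 \<alpha>. T u \<in> A2 \<alpha> \<and> knorm2 (T u) \<le> C * knorm2 u"
proof -
  obtain c C where cC: "0 < c" "0 < C"
    "\<And>f. weighted_norm2 \<alpha> f \<le> ennreal c * (\<Sum>m. ennreal ((cmod (taylor_coeff f m))\<^sup>2 / \<kappa> m))"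
    "\<And>f. (\<Sum>m. ennreal ((cmod (taylor_coeff f m))\<^sup>2 / \<kappa> m)) \<le> ennreal C * weighted_norm2 \<alpha> f"
    using that by (rule weighted_norm2_kernel_comparable)
  have k: "(\<Sum>m. ennreal ((cmod (taylor_coeff f m))\<^sup>2 / \<kappa> m)) = ennreal (knorm2 f)" if "f \<in> A2 \<alpha>" for f
    unfolding knorm2_def by (intro suminf_ennreal2 A2_summable that) (auto simp: less_imp_le[OF \<kappa>_pos])
  \<comment> \<open>\<open>ennreal K\<close> is 0 for negative \<open>K\<close>, so the real
    constant is built from \<open>max K 0\<close>.\<close>
  have "T u \<in> A2 \<alpha> \<and> knorm2 (T u) \<le> C * (max K 0 * c) * knorm2 u" if u: "u \<in> A2 \<alpha>" for u
  proof
    have "weighted_norm2 \<alpha> u < \<infinity>" using u by (simp add: A2_iff)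
    then have "weighted_norm2 \<alpha> (T u) < \<infinity>"
      by (intro le_less_trans[OF assms(3)[OF u]]) (simp add: ennreal_mult_less_top)
    then show Tu: "T u \<in> A2 \<alpha>" using assms u by (auto simp: A2_iff)
    have "ennreal (knorm2 (T u)) \<le> ennreal C * (ennreal (max K 0) * (ennreal c * ennreal (knorm2 u)))"
      unfolding k[OF u, symmetric] k[OF Tu, symmetric]
      by (rule order_trans[OF cC(4) mult_left_mono[OF order_trans[OF assms(3)[OF u] mult_mono[OF _ cC(3)]]]])
        (auto intro: ennreal_leI)
    then show "knorm2 (T u) \<le> C * (max K 0 * c) * knorm2 u"
      using cC knorm2_nonneg[OF u] by (simp add: ennreal_mult[symmetric] mult.assoc)
  qed
  moreover have "0 \<le> C * (max K 0 * c)" using cC by simp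
  ultimately show ?thesis by blast
qed

text \<open>Cauchy-Schwarz on partial sums bounds the absolute series uniformly, so convergence and
  the norm estimate come out together.\<close>

lemma ip_sums_and_bound:
  assumes "f \<in> A2 \<alpha>" "g \<in> A2 \<alpha>"
  shows ip_sums: "(\<lambda>m. taylor_coeff f m * cnj (taylor_coeff g m) / of_real (\<kappa> m)) sums ip f g"
    and cauchy_schwarz: "cmod (ip f g) \<le> sqrt (knorm2 f) * sqrt (knorm2 g)"
proof -
  define t where "t m = taylor_coeff f m * cnj (taylor_coeff g m) / of_real (\<kappa> m)" for m
  have part: "(\<Sum>m<n. cmod (t m)) \<le> sqrt (knorm2 f) * sqrt (knorm2 g)" for n
  proof -
    have "(\<Sum>m<n. cmod (t m)) = (\<Sum>m<n. \<bar>cmod (taylor_coeff f m) / sqrt (\<kappa> m)\<bar> * \<bar>cmod (taylor_coeff g m) / sqrt (\<kappa> m)\<bar>)"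
      using \<kappa>_pos by (intro sum.cong) (auto simp: t_def norm_mult norm_divide less_imp_le)
    also have "\<dots> \<le> L2_set (\<lambda>m. cmod (taylor_coeff f m) / sqrt (\<kappa> m)) {..<n} * L2_set (\<lambda>m. cmod (taylor_coeff g m) / sqrt (\<kappa> m)) {..<n}"
      by (rule L2_set_mult_ineq)
    also have "\<dots> = sqrt (\<Sum>m<n. (cmod (taylor_coeff f m))\<^sup>2 / \<kappa> m) * sqrt (\<Sum>m<n. (cmod (taylor_coeff g m))\<^sup>2 / \<kappa> m)"
      using \<kappa>_pos by (simp add: L2_set_def power_divide less_imp_le)
    also have "\<dots> \<le> sqrt (knorm2 f) * sqrt (knorm2 g)"
      using assms by (intro mult_mono real_sqrt_le_mono partial_knorm2_le)
        (auto intro!: sum_nonneg knorm2_nonneg divide_nonneg_nonneg simp: less_imp_le[OF \<kappa>_pos])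
    finally show ?thesis .
  qed
  have s: "summable (\<lambda>m. cmod (t m))"
    by (rule summableI_nonneg_bounded[OF _ part]) auto
  show "(\<lambda>m. taylor_coeff f m * cnj (taylor_coeff g m) / of_real (\<kappa> m)) sums ip f g"
    unfolding ip_def using summable_norm_cancel[OF s] by (simp add: t_def summable_sums)
  have "cmod (ip f g) \<le> (\<Sum>m. cmod (t m))"
    unfolding ip_def t_def[symmetric] by (rule summable_norm[OF s])
  also have "\<dots> \<le> sqrt (knorm2 f) * sqrt (knorm2 g)"
    by (rule suminf_le_const[OF s part])
  finally show "cmod (ip f g) \<le> sqrt (knorm2 f) * sqrt (knorm2 g)" .
qed

lemma cnj_ip: "f \<in> A2 \<alpha> \<Longrightarrow> g \<in> A2 \<alpha> \<Longrightarrow> cnj (ip f g) = ip g f"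
  using ip_sums[of f g, THEN sums_cnj[THEN iffD2]] ip_sums[of g f]
  by (auto intro: sums_unique2 simp: mult.commute)

lemma A2_lincomb:
  assumes f: "f \<in> A2 \<alpha>" and g: "g \<in> A2 \<alpha>"
  shows "(\<lambda>z. x * f z + y * g z) \<in> A2 \<alpha>"
    and "taylor_coeff (\<lambda>z. x * f z + y * g z) m = x * taylor_coeff f m + y * taylor_coeff g m"
proof -
  have h: "(\<lambda>z. x * f z) holomorphic_on unit_disk" "(\<lambda>z. y * g z) holomorphic_on unit_disk"
    by (intro holomorphic_intros A2_holomorphic f g)+
  show tc: "taylor_coeff (\<lambda>z. x * f z + y * g z) m = x * taylor_coeff f m + y * taylor_coeff g m" for m
    by (simp add: taylor_coeff_add[OF h] taylor_coeff_cmult A2_holomorphic f g)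
  have cm: "weighted_norm2 \<alpha> (\<lambda>z. x * f z) < \<infinity>" if "f \<in> A2 \<alpha>" for x f
    unfolding weighted_norm2_finite_iff using summable_mult[OF A2_summable[OF that], of "(cmod x)\<^sup>2"]
    by (simp add: taylor_coeff_cmult A2_holomorphic that norm_mult power_mult_distrib)
  have "weighted_norm2 \<alpha> (\<lambda>z. x * f z + y * g z) < \<infinity>"
    using cm[OF f, of x] cm[OF g, of y]
    by (intro le_less_trans[OF weighted_norm2_add_le[OF h]]) (auto simp: ennreal_mult_less_top)
  then show "(\<lambda>z. x * f z + y * g z) \<in> A2 \<alpha>"
    using h f g by (auto simp: A2_iff intro!: holomorphic_on_add)
qed

lemma ip_lincomb:
  assumes f: "f \<in> A2 \<alpha>" and g: "g \<in> A2 \<alpha>" and u: "u \<in> A2 \<alpha>"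
  shows "ip (\<lambda>z. x * f z + y * g z) u = x * ip f u + y * ip g u"
proof -
  have "(\<lambda>m. x * (taylor_coeff f m * cnj (taylor_coeff u m) / of_real (\<kappa> m)) + y * (taylor_coeff g m * cnj (taylor_coeff u m) / of_real (\<kappa> m))) sums (x * ip f u + y * ip g u)"
    by (intro sums_add sums_mult ip_sums assms)
  moreover have "(\<lambda>m. taylor_coeff (\<lambda>z. x * f z + y * g z) m * cnj (taylor_coeff u m) / of_real (\<kappa> m)) sums ip (\<lambda>z. x * f z + y * g z) u"
    by (intro ip_sums A2_lincomb assms)
  ultimately show ?thesis
    by (auto simp: A2_lincomb(2)[OF f g] algebra_simps add_divide_distrib intro: sums_unique2)
qed

lemma zero_in_A2: "(\<lambda>z. 0) \<in> A2 \<alpha>"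
  by (auto simp: A2_iff_summable taylor_coeff_def)

lemma ip_zero: "ip (\<lambda>z. 0) u = 0"
  by (simp add: ip_def taylor_coeff_def)

lemma A2_sum:
  assumes "finite I" "\<And>i. i \<in> I \<Longrightarrow> e i \<in> A2 \<alpha>" "u \<in> A2 \<alpha>"
  shows "(\<lambda>z. \<Sum>i\<in>I. x i * e i z) \<in> A2 \<alpha> \<and> ip (\<lambda>z. \<Sum>i\<in>I. x i * e i z) u = (\<Sum>i\<in>I. x i * ip (e i) u)"
  using assms(1,2)
proof (induction I rule: finite_induct)
  case empty
  then show ?case using zero_in_A2 ip_zero by simp
next
  case (insert j I)
  then show ?case
    using A2_lincomb(1)[of "e j" "\<lambda>z. \<Sum>i\<in>I. x i * e i z" "x j" 1]
      ip_lincomb[of "e j" "\<lambda>z. \<Sum>i\<in>I. x i * e i z" u "x j" 1] assms(3) by simp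
qed

section \<open>Elements of \<open>A2\<close> built from their Taylor coefficients\<close>

definition ser :: "(nat \<Rightarrow> complex) \<Rightarrow> complex \<Rightarrow> complex" where
  "ser a z = (if cmod z < 1 then \<Sum>m. a m * z ^ m else 0)"

text \<open>Weighted square summability forces polynomial growth of the coefficients, hence
  convergence on the whole disk. This is the completeness of \<open>A2\<close> in
  coordinates.\<close>

lemma ser_properties:
  assumes "summable (\<lambda>m. (cmod (a m))\<^sup>2 / \<kappa> m)"
  shows ser_sums: "cmod z < 1 \<Longrightarrow> (\<lambda>m. a m * z ^ m) sums ser a z"
    and taylor_coeff_ser: "taylor_coeff (ser a) m = a m"
    and ser_in_A2: "ser a \<in> A2 \<alpha>"
proof -
  obtain c C where C: "0 < c" "0 < C" "\<And>n. c * (real n + 1) powr (\<alpha> + 1) \<le> \<kappa> n" "\<And>n. \<kappa> n \<le> C * (real n + 1) powr (\<alpha> + 1)"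
    using that by (rule \<kappa>_comparable)
  define S where "S = (\<Sum>m. (cmod (a m))\<^sup>2 / \<kappa> m)"
  have S0: "0 \<le> S" unfolding S_def by (intro suminf_nonneg assms) (auto simp: less_imp_le[OF \<kappa>_pos])
  have le: "cmod (a m) \<le> sqrt (S * C) * (real m + 1) powr ((\<alpha> + 1) / 2)" for m
  proof -
    have "(cmod (a m))\<^sup>2 / \<kappa> m \<le> S"
      unfolding S_def using sum_le_suminf[OF assms, of "{m}"] by (simp add: less_imp_le[OF \<kappa>_pos])
    then have "(cmod (a m))\<^sup>2 \<le> S * \<kappa> m" using \<kappa>_pos[of m] by (simp add: field_simps)
    also have "\<dots> \<le> S * (C * (real m + 1) powr (\<alpha> + 1))" using S0 C by (intro mult_left_mono) auto
    also have "(real m + 1) powr (\<alpha> + 1) = ((real m + 1) powr ((\<alpha> + 1) / 2))\<^sup>2"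
      by (simp add: power2_eq_square powr_add[symmetric])
    finally have "sqrt ((cmod (a m))\<^sup>2) \<le> sqrt (S * C * ((real m + 1) powr ((\<alpha> + 1) / 2))\<^sup>2)"
      by (intro real_sqrt_le_mono) (simp add: mult.assoc)
    then show ?thesis by (simp add: real_sqrt_mult)
  qed
  show sums: "(\<lambda>m. a m * z ^ m) sums ser a z" if z: "cmod z < 1" for z
  proof -
    have "summable (\<lambda>m. sqrt (S * C) * (cmod z ^ m * (real m + 1) powr ((\<alpha> + 1) / 2)))"
      using z by (intro summable_mult summable_geometric_powr) auto
    then have "summable (\<lambda>m. a m * z ^ m)"
    proof (rule summable_comparison_test'[where N = 0])
      fix m
      show "norm (a m * z ^ m) \<le> sqrt (S * C) * (cmod z ^ m * (real m + 1) powr ((\<alpha> + 1) / 2))"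
        using mult_right_mono[OF le[of m], of "cmod z ^ m"] by (simp add: norm_mult norm_power mult_ac)
    qed
    then show ?thesis using z by (simp add: ser_def summable_sums)
  qed
  show tc: "taylor_coeff (ser a) m = a m" for m
    by (rule taylor_coeff_eqI) (rule sums)
  have "ser a holomorphic_on unit_disk"
    using sums by (intro power_series_holomorphic[where a = a]) auto
  then show "ser a \<in> A2 \<alpha>" using assms by (auto simp: A2_iff_summable tc ser_def)
qed

definition disk_monom :: "nat \<Rightarrow> complex \<Rightarrow> complex" where
  "disk_monom n = ser (\<lambda>m. if m = n then 1 else 0)"

lemma disk_monom_summable: "summable (\<lambda>m. (cmod (if m = n then 1 else 0))\<^sup>2 / \<kappa> m)"
  by (rule summable_finite[of "{n}"]) auto

lemma disk_monom_in_A2: "disk_monom n \<in> A2 \<alpha>"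
  and taylor_coeff_disk_monom: "taylor_coeff (disk_monom n) m = (if m = n then 1 else 0)"
  and disk_monom_eq: "disk_monom n z = (if cmod z < 1 then z ^ n else 0)"
proof -
  show "disk_monom n \<in> A2 \<alpha>" "taylor_coeff (disk_monom n) m = (if m = n then 1 else 0)"
    unfolding disk_monom_def using ser_in_A2[OF disk_monom_summable] taylor_coeff_ser[OF disk_monom_summable] by auto
  have "(\<lambda>m. (if m = n then 1 else 0) * z ^ m) sums (\<Sum>m\<in>{n}. (if m = n then 1 else 0) * z ^ m)"
    by (rule sums_finite) auto
  then show "disk_monom n z = (if cmod z < 1 then z ^ n else 0)"
    unfolding disk_monom_def ser_def by (simp add: sums_iff)
qed

lemma A2_eqI:
  assumes "f \<in> A2 \<alpha>" "g \<in> A2 \<alpha>" "\<And>m. taylor_coeff f m = taylor_coeff g m"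
  shows "f = g"
proof
  fix z show "f z = g z"
    using taylor_coeff_sums[OF A2_holomorphic[OF assms(1)], of z] taylor_coeff_sums[OF A2_holomorphic[OF assms(2)], of z]
      A2_off[OF assms(1), of z] A2_off[OF assms(2), of z] assms(3)
    by (cases "cmod z < 1") (auto simp: sums_iff)
qed

lemma ip_disk_monom:
  "ip (disk_monom n) g = cnj (taylor_coeff g n) / of_real (\<kappa> n)"
proof -
  have "(\<lambda>m. taylor_coeff (disk_monom n) m * cnj (taylor_coeff g m) / of_real (\<kappa> m)) sums
     (\<Sum>m\<in>{n}. taylor_coeff (disk_monom n) m * cnj (taylor_coeff g m) / of_real (\<kappa> m))"
    by (rule sums_finite) (auto simp: taylor_coeff_disk_monom)
  then show ?thesis unfolding ip_def by (simp add: sums_iff taylor_coeff_disk_monom)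
qed

lemma truncation:
  fixes a :: "nat \<Rightarrow> complex" and n :: nat
  defines "p \<equiv> \<lambda>z. \<Sum>m<n. a m * disk_monom m z"
  shows "p \<in> A2 \<alpha>" "taylor_coeff p m = (if m < n then a m else 0)"
    "knorm2 p = (\<Sum>m<n. (cmod (a m))\<^sup>2 / \<kappa> m)"
proof -
  show p: "p \<in> A2 \<alpha>" unfolding p_def using A2_sum[of "{..<n}" disk_monom, OF _ _ zero_in_A2] disk_monom_in_A2 by auto
  show tc: "taylor_coeff p m = (if m < n then a m else 0)" for m
  proof -
    \<comment> \<open>The coefficient is read off by pairing with a monomial, so no finite sum has
      to be differentiated.\<close>
    have "ip p (disk_monom m) = (\<Sum>k<n. a k * ip (disk_monom k) (disk_monom m))"
      unfolding p_def using A2_sum[of "{..<n}" disk_monom "disk_monom m"] disk_monom_in_A2 by auto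
    also have "\<dots> = (\<Sum>k<n. if k = m then a m / of_real (\<kappa> m) else 0)"
      by (intro sum.cong) (auto simp: ip_disk_monom taylor_coeff_disk_monom)
    also have "\<dots> = (if m < n then a m else 0) / of_real (\<kappa> m)" by simp
    finally have "cnj (ip (disk_monom m) p) = (if m < n then a m else 0) / of_real (\<kappa> m)"
      by (simp add: cnj_ip p disk_monom_in_A2)
    then show ?thesis using \<kappa>_pos[of m] by (auto simp: ip_disk_monom split: if_splits)
  qed
  have "(\<lambda>m. (cmod (taylor_coeff p m))\<^sup>2 / \<kappa> m) sums (\<Sum>m<n. (cmod (taylor_coeff p m))\<^sup>2 / \<kappa> m)"
    by (rule sums_finite) (auto simp: tc)
  then show "knorm2 p = (\<Sum>m<n. (cmod (a m))\<^sup>2 / \<kappa> m)"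
    unfolding knorm2_def by (simp add: sums_iff tc)
qed

text \<open>The remainder keeps the coefficients of u from n on, so its norm is a tail of a
  convergent series. The factors 1 and -1 match the shape of \<open>A2_lincomb\<close>.\<close>

lemma knorm2_tail_tendsto:
  assumes u: "u \<in> A2 \<alpha>"
  shows "(\<lambda>n. knorm2 (\<lambda>z. 1 * u z + (-1) * (\<Sum>m<n. taylor_coeff u m * disk_monom m z))) \<longlonglongrightarrow> 0"
proof -
  define x where "x m = (cmod (taylor_coeff u m))\<^sup>2 / \<kappa> m" for m
  have x: "x sums knorm2 u" unfolding x_def knorm2_def using A2_summable[OF u] by (rule summable_sums)
  have "knorm2 (\<lambda>z. 1 * u z + (-1) * (\<Sum>m<n. taylor_coeff u m * disk_monom m z)) = knorm2 u - (\<Sum>m<n. x m)" for n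
  proof -
    have "(\<lambda>m. x m - (if m \<in> {..<n} then x m else 0)) sums (knorm2 u - (\<Sum>m<n. x m))"
      by (intro sums_diff x sums_If_finite_set) auto
    also have "(\<lambda>m. x m - (if m \<in> {..<n} then x m else 0)) =
       (\<lambda>m. (cmod (taylor_coeff (\<lambda>z. 1 * u z + (-1) * (\<Sum>m<n. taylor_coeff u m * disk_monom m z)) m))\<^sup>2 / \<kappa> m)"
      by (subst A2_lincomb(2)[OF u truncation(1)], subst truncation(2)) (auto simp: x_def)
    finally show ?thesis unfolding knorm2_def by (simp add: sums_iff)
  qed
  moreover have "(\<lambda>n. knorm2 u - (\<Sum>m<n. x m)) \<longlonglongrightarrow> knorm2 u - knorm2 u"
    using x unfolding sums_def by (intro tendsto_intros)
  ultimately show ?thesis by simp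
qed

text \<open>Riesz representation in coordinates. The bounded functional L u = <T u, f> is determined
  by its values on monomials, and these values prescribe the coefficients of the representing
  function.\<close>

lemma adjoint_exists_unique:
  assumes C: "0 \<le> C" and bdd: "\<And>u. u \<in> A2 \<alpha> \<Longrightarrow> T u \<in> A2 \<alpha> \<and> knorm2 (T u) \<le> C * knorm2 u"
    and lin: "\<And>u v x y. T (\<lambda>z. x * u z + y * v z) = (\<lambda>z. x * T u z + y * T v z)"
    and f: "f \<in> A2 \<alpha>"
  shows "\<exists>!g. g \<in> A2 \<alpha> \<and> (\<forall>u\<in>A2 \<alpha>. ip (T u) f = ip u g)"
proof -
  define L where "L u = ip (T u) f" for u
  define M where "M = sqrt C * sqrt (knorm2 f)"
  have M0: "0 \<le> M" using C knorm2_nonneg[OF f] by (simp add: M_def)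
  have L_bound: "cmod (L u) \<le> M * sqrt (knorm2 u)" if u: "u \<in> A2 \<alpha>" for u
  proof -
    have "cmod (L u) \<le> sqrt (knorm2 (T u)) * sqrt (knorm2 f)"
      unfolding L_def using bdd[OF u] f by (intro cauchy_schwarz) auto
    also have "\<dots> \<le> sqrt (C * knorm2 u) * sqrt (knorm2 f)"
      using bdd[OF u] knorm2_nonneg[OF f] by (intro mult_right_mono real_sqrt_le_mono) auto
    finally show ?thesis by (simp add: M_def real_sqrt_mult mult_ac)
  qed
  have L_lin: "L (\<lambda>z. x * u z + y * v z) = x * L u + y * L v" if "u \<in> A2 \<alpha>" "v \<in> A2 \<alpha>" for u v x y
    unfolding L_def lin using bdd that f by (intro ip_lincomb) auto
  have L_zero: "L (\<lambda>z. 0) = 0"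
    using L_lin[OF zero_in_A2 zero_in_A2, of 0 0] by simp
  have L_trunc: "L (\<lambda>z. \<Sum>m<n. a m * disk_monom m z) = (\<Sum>m<n. a m * L (disk_monom m))" for a n
  proof (induction n)
    case (Suc n)
    then show ?case
      using L_lin[OF truncation(1)[where a = a and n = n] disk_monom_in_A2[of n], of 1 "a n"] by simp
  qed (simp add: L_zero)
  have L_sums: "(\<lambda>m. taylor_coeff u m * L (disk_monom m)) sums L u" if u: "u \<in> A2 \<alpha>" for u
  proof -
    define r where "r n = (\<lambda>z. 1 * u z + (-1) * (\<Sum>m<n. taylor_coeff u m * disk_monom m z))" for n
    have r: "r n \<in> A2 \<alpha>" for n unfolding r_def by (intro A2_lincomb u truncation)
    have "L (r n) = L u - (\<Sum>m<n. taylor_coeff u m * L (disk_monom m))" for n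
      unfolding r_def by (subst L_lin[OF u truncation(1)]) (simp add: L_trunc)
    moreover have "(\<lambda>n. L (r n)) \<longlonglongrightarrow> 0"
    proof (rule Lim_null_comparison)
      show "\<forall>\<^sub>F n in sequentially. cmod (L (r n)) \<le> M * sqrt (knorm2 (r n))"
        using L_bound[OF r] by simp
      have "(\<lambda>n. M * sqrt (knorm2 (r n))) \<longlonglongrightarrow> M * sqrt 0"
        unfolding r_def by (intro tendsto_intros knorm2_tail_tendsto u)
      then show "(\<lambda>n. M * sqrt (knorm2 (r n))) \<longlonglongrightarrow> 0" by simp
    qed
    ultimately have "(\<lambda>n. L u - (\<Sum>m<n. taylor_coeff u m * L (disk_monom m))) \<longlonglongrightarrow> 0" by simp
    from tendsto_diff[OF tendsto_const[of "L u"] this] show ?thesis by (simp add: sums_def)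
  qed
  \<comment> \<open>A representing g must satisfy L(z^m) = <z^m, g> = conj(g_m)/\<kappa> m, which
    leaves only this choice.\<close>
  define a where "a m = of_real (\<kappa> m) * cnj (L (disk_monom m))" for m
  have a: "(cmod (a m))\<^sup>2 / \<kappa> m = \<kappa> m * (cmod (L (disk_monom m)))\<^sup>2" for m
    using \<kappa>_pos[of m] by (simp add: a_def norm_mult power_mult_distrib power2_eq_square)
  \<comment> \<open>L is tested on the truncation of the candidate itself. There it takes the value
    S, the squared norm of that truncation, so S \<le> M sqrt S.\<close>
  have "(\<Sum>m<n. (cmod (a m))\<^sup>2 / \<kappa> m) \<le> M\<^sup>2" for n
  proof -
    define S where "S = (\<Sum>m<n. (cmod (a m))\<^sup>2 / \<kappa> m)"
    have S0: "0 \<le> S" unfolding S_def by (intro sum_nonneg) (auto simp: less_imp_le[OF \<kappa>_pos])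
    have "L (\<lambda>z. \<Sum>m<n. a m * disk_monom m z) = of_real S"
      unfolding L_trunc S_def a of_real_sum of_real_mult complex_norm_square by (simp add: a_def mult_ac)
    then have "S \<le> M * sqrt S"
      using L_bound[OF truncation(1)[where a = a and n = n]] S0 by (simp add: truncation(3) S_def[symmetric])
    then have "S * S \<le> M\<^sup>2 * S"
      using mult_mono[OF \<open>S \<le> M * sqrt S\<close> \<open>S \<le> M * sqrt S\<close>] S0 M0 by (simp add: power2_eq_square mult_ac)
    then show ?thesis unfolding S_def[symmetric] using S0 by (cases "S = 0") auto
  qed
  then have sa: "summable (\<lambda>m. (cmod (a m))\<^sup>2 / \<kappa> m)"
    by (intro summableI_nonneg_bounded[where x = "M\<^sup>2"]) (auto simp: less_imp_le[OF \<kappa>_pos])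
  have ip_ser: "ip u (ser a) = L u" if u: "u \<in> A2 \<alpha>" for u
  proof -
    have eq: "taylor_coeff u m * cnj (taylor_coeff (ser a) m) / of_real (\<kappa> m) = taylor_coeff u m * L (disk_monom m)" for m
      unfolding taylor_coeff_ser[OF sa] using \<kappa>_pos[of m] by (simp add: a_def)
    have "(\<lambda>m. taylor_coeff u m * L (disk_monom m)) sums ip u (ser a)"
      using ip_sums[OF u ser_in_A2[OF sa]] unfolding eq .
    then show ?thesis using L_sums[OF u] by (rule sums_unique2)
  qed
  show ?thesis
  proof (rule ex1I[of _ "ser a"])
    show "ser a \<in> A2 \<alpha> \<and> (\<forall>u\<in>A2 \<alpha>. ip (T u) f = ip u (ser a))"
      using ser_in_A2[OF sa] ip_ser by (auto simp: L_def)
    fix g assume g: "g \<in> A2 \<alpha> \<and> (\<forall>u\<in>A2 \<alpha>. ip (T u) f = ip u g)"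
    show "g = ser a"
    proof (rule A2_eqI)
      fix m
      have "ip (disk_monom m) g = ip (disk_monom m) (ser a)" using g ip_ser[OF disk_monom_in_A2] disk_monom_in_A2 by (simp add: L_def)
      then show "taylor_coeff g m = taylor_coeff (ser a) m" using \<kappa>_pos[of m] by (simp add: ip_disk_monom)
    qed (use g ser_in_A2[OF sa] in auto)
  qed
qed

section \<open>Reproducing kernels and the values of adjoints\<close>

definition rep_kernel :: "complex \<Rightarrow> complex \<Rightarrow> complex" where
  "rep_kernel w = ser (\<lambda>m. of_real (\<kappa> m) * cnj w ^ m)"

lemma rep_kernel_summable:
  assumes "cmod w < 1"
  shows "summable (\<lambda>m. (cmod (of_real (\<kappa> m) * cnj w ^ m))\<^sup>2 / \<kappa> m)"
proof -
  obtain c C where C: "0 < c" "0 < C" "\<And>n. c * (real n + 1) powr (\<alpha> + 1) \<le> \<kappa> n" "\<And>n. \<kappa> n \<le> C * (real n + 1) powr (\<alpha> + 1)"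
    using that by (rule \<kappa>_comparable)
  have "summable (\<lambda>m. C * (((cmod w)\<^sup>2) ^ m * (real m + 1) powr (\<alpha> + 1)))"
    using assms by (intro summable_mult summable_geometric_powr) (auto simp: power_less_one_iff)
  then show ?thesis
  proof (rule summable_comparison_test'[where N = 0])
    fix m
    have "(cmod (of_real (\<kappa> m) * cnj w ^ m))\<^sup>2 / \<kappa> m = ((cmod w)\<^sup>2) ^ m * \<kappa> m"
      using \<kappa>_pos[of m] by (simp add: norm_mult norm_power power_mult_distrib power2_eq_square)
    also have "\<dots> \<le> ((cmod w)\<^sup>2) ^ m * (C * (real m + 1) powr (\<alpha> + 1))"
      using C by (intro mult_left_mono) auto
    finally show "norm ((cmod (of_real (\<kappa> m) * cnj w ^ m))\<^sup>2 / \<kappa> m) \<le> C * (((cmod w)\<^sup>2) ^ m * (real m + 1) powr (\<alpha> + 1))"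
      using \<kappa>_pos[of m] by (simp add: mult_ac less_imp_le)
  qed
qed

lemma rep_kernel_in_A2: "cmod w < 1 \<Longrightarrow> rep_kernel w \<in> A2 \<alpha>"
  unfolding rep_kernel_def by (intro ser_in_A2 rep_kernel_summable)

lemma rep_kernel_eq:
  assumes "cmod w < 1" "cmod z < 1"
  shows "rep_kernel w z = kernel_profile \<alpha> N Q (z * cnj w)"
proof -
  have "cmod (z * cnj w) < 1"
    using assms mult_strict_mono[of "cmod z" 1 "cmod w" 1] by (simp add: norm_mult)
  then show ?thesis
    using ser_sums[OF rep_kernel_summable[OF assms(1)] assms(2)] kernel_sums[of "z * cnj w"]
    by (auto simp: rep_kernel_def power_mult_distrib mult_ac intro: sums_unique2)
qed

text \<open>The factor \<kappa> m in the kernel cancels the one in the inner product and leaves the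
  Taylor series of u at w.\<close>

lemma ip_rep_kernel:
  assumes u: "u \<in> A2 \<alpha>" and w: "cmod w < 1"
  shows "ip u (rep_kernel w) = u w"
proof -
  have "(\<lambda>m. taylor_coeff u m * w ^ m) sums ip u (rep_kernel w)"
    using ip_sums[OF u rep_kernel_in_A2[OF w]] \<kappa>_pos[THEN less_imp_neq]
    by (simp add: rep_kernel_def taylor_coeff_ser[OF rep_kernel_summable[OF w]])
  then show ?thesis using taylor_coeff_sums[OF A2_holomorphic[OF u] w] by (rule sums_unique2)
qed

lemma A2_adjoint_in_A2_and_eval:
  assumes "0 \<le> C" and bdd: "\<And>u. u \<in> A2 \<alpha> \<Longrightarrow> T u \<in> A2 \<alpha> \<and> knorm2 (T u) \<le> C * knorm2 u"
    and "\<And>u v x y. T (\<lambda>z. x * u z + y * v z) = (\<lambda>z. x * T u z + y * T v z)"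
    and f: "f \<in> A2 \<alpha>"
  shows A2_adjoint_in_A2: "A2_adjoint \<alpha> N Q T f \<in> A2 \<alpha>"
    and A2_adjoint_eval: "cmod w < 1 \<Longrightarrow> A2_adjoint \<alpha> N Q T f w = cnj (ip (T (rep_kernel w)) f)"
proof -
  have *: "A2_adjoint \<alpha> N Q T f \<in> A2 \<alpha> \<and> (\<forall>u\<in>A2 \<alpha>. ip (T u) f = ip u (A2_adjoint \<alpha> N Q T f))"
    unfolding A2_adjoint_def by (rule theI'[OF adjoint_exists_unique[OF assms]])
  then show "A2_adjoint \<alpha> N Q T f \<in> A2 \<alpha>" by blast
  show "A2_adjoint \<alpha> N Q T f w = cnj (ip (T (rep_kernel w)) f)" if w: "cmod w < 1"
    using * rep_kernel_in_A2[OF w] by (simp add: ip_rep_kernel[OF _ w, symmetric] cnj_ip)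
qed

end

section \<open>Comparison of the two adjoints\<close>

lemma Re_affine_pos:
  assumes "cmod q < 1" "cmod z \<le> 1"
  shows "0 < Re (1 + q * z)"
proof -
  have "cmod (q * z) < 1" using assms mult_left_le[of "cmod z" "cmod q"] by (simp add: norm_mult)
  then show ?thesis using abs_Re_le_cmod[of "q * z"] by simp
qed

text \<open>The radius R = 2/(1 + |q|) satisfies |q| R < 1 < R, so 1 + q z avoids the cut of the
  logarithm on a disk larger than the unit disk.\<close>

lemma exp_Ln_affine_extends:
  assumes "cmod q < 1"
  obtains R where "1 < R" "(\<lambda>z. k * exp (t * Ln (1 + q * z))) holomorphic_on ball 0 R"
proof
  define R where "R = 2 / (1 + cmod q)"
  have pos: "0 < 1 + cmod q" by (simp add: add_pos_nonneg)
  show "1 < R" using assms pos by (simp add: R_def)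
  have "1 + q * z \<notin> \<real>\<^sub>\<le>\<^sub>0" if "z \<in> ball 0 R" for z
  proof -
    have "cmod q * cmod z \<le> cmod q * R" using that by (intro mult_left_mono) auto
    also have "\<dots> < 1" using assms pos by (simp add: R_def divide_simps)
    finally have "\<bar>Re (q * z)\<bar> < 1" using abs_Re_le_cmod[of "q * z"] by (simp add: norm_mult)
    then show ?thesis by (auto simp: complex_nonpos_Reals_iff)
  qed
  then show "(\<lambda>z. k * exp (t * Ln (1 + q * z))) holomorphic_on ball 0 R"
    by (intro holomorphic_intros) auto
qed

text \<open>Any branch of the logarithm of p z + q has the derivative of Ln(1 + (p/q) z), so the two
  differ by a constant. The branch of the power is therefore fixed by its value at 0.\<close>

lemma power_branch_affine_eq:
  assumes pb: "power_branch (\<lambda>z. p * z + q) s g" and pq: "cmod p < cmod q" and z: "cmod z < 1"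
  shows "g z = g 0 * exp (of_real s * Ln (1 + (p / q) * z))"
proof -
  obtain L where L: "L holomorphic_on unit_disk" "\<And>z. z \<in> unit_disk \<Longrightarrow> exp (L z) = p * z + q"
    "\<And>z. z \<in> unit_disk \<Longrightarrow> g z = exp (of_real s * L z)"
    using pb unfolding power_branch_def by blast
  have q0: "q \<noteq> 0" using pq by auto
  have pq1: "cmod (p / q) < 1" using pq by (simp add: norm_divide divide_simps)
  have nz: "p * x + q \<noteq> 0" if "x \<in> unit_disk" for x using affine_nonzero[OF pq] that by simp
  have der: "((\<lambda>x. L x - Ln (1 + (p / q) * x)) has_field_derivative 0) (at x within unit_disk)" if x: "x \<in> unit_disk" for x
  proof -
    have "(L has_field_derivative deriv L x) (at x)" using L(1) x by (intro holomorphic_derivI[of _ unit_disk]) auto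
    then have "((\<lambda>x. exp (L x)) has_field_derivative exp (L x) * deriv L x) (at x)"
      by (auto intro!: derivative_eq_intros)
    then have "((\<lambda>x. p * x + q) has_field_derivative exp (L x) * deriv L x) (at x)"
      by (rule has_field_derivative_transform_within_open[where S = unit_disk]) (use L(2) x in auto)
    moreover have "((\<lambda>x. p * x + q) has_field_derivative p) (at x)"
      by (auto intro!: derivative_eq_intros)
    ultimately have "exp (L x) * deriv L x = p" by (rule DERIV_unique)
    then have dL: "deriv L x = p / (p * x + q)" using L(2)[OF x] nz[OF x] by (simp add: field_simps)
    have "1 + (p / q) * x \<notin> \<real>\<^sub>\<le>\<^sub>0"
      using Re_affine_pos[OF pq1, of x] x by (auto simp: complex_nonpos_Reals_iff)
    then have "((\<lambda>x. Ln (1 + (p / q) * x)) has_field_derivative (p / q) / (1 + (p / q) * x)) (at x)"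
      using q0 by (auto intro!: derivative_eq_intros simp: divide_inverse mult_ac)
    also have "(p / q) / (1 + (p / q) * x) = p / (p * x + q)"
      using q0 nz[OF x] by (simp add: divide_simps add.commute)
    finally have "((\<lambda>x. L x - Ln (1 + (p / q) * x)) has_field_derivative (deriv L x - p / (p * x + q))) (at x)"
      using \<open>(L has_field_derivative deriv L x) (at x)\<close> by (intro DERIV_diff)
    then show ?thesis using dL by (simp add: has_field_derivative_at_within)
  qed
  obtain k where k: "\<And>x. x \<in> unit_disk \<Longrightarrow> L x - Ln (1 + (p / q) * x) = k"
    using has_field_derivative_zero_constant[of unit_disk "\<lambda>x. L x - Ln (1 + (p / q) * x)"] der by auto
  have "L z = L 0 + Ln (1 + (p / q) * z)" using k[of z] k[of 0] z by (simp add: algebra_simps)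
  then show ?thesis using L(3)[of z] L(3)[of 0] z by (simp add: distrib_left exp_add)
qed

text \<open>All four logarithms have arguments in the right half-plane, so their imaginary parts are below
  \<open>pi / 2\<close> in modulus and the combination, a priori in \<open>2 pi i \<int>\<close>, vanishes.\<close>

lemma Ln_mult_eq_of_Re_pos:
  assumes "0 < Re A" "0 < Re B" "0 < Re C" "0 < Re D" "A * B = C * D"
  shows "Ln A + Ln B = Ln C + Ln D"
proof -
  have nz: "A \<noteq> 0" "B \<noteq> 0" "C \<noteq> 0" "D \<noteq> 0" using assms by auto
  have im: "\<bar>Im (Ln X)\<bar> < pi / 2" if "0 < Re X" for X
    using that Re_Ln_pos_lt[of X] by force
  have e: "exp (Ln A + Ln B) = exp (Ln C + Ln D)"
    using assms nz by (simp add: exp_add)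
  show ?thesis
    by (rule exp_complex_eqI[OF _ e]) (use im[OF assms(1)] im[OF assms(2)] im[OF assms(3)] im[OF assms(4)] in auto)
qed

context A2_space
begin

text \<open>One statement for three operators: composition with \<phi> (H = 1), multiplication by h
  (identity map), and multiplication by g after composition with \<sigma>.\<close>

lemma weighted_comp_in_A2:
  assumes det: "a * d - b * c \<noteq> 0" and self: "lin_frac a b c d ` unit_disk \<subseteq> unit_disk"
    and H: "H holomorphic_on ball 0 R" "1 < R"
    and T: "\<And>u z. u \<in> A2 \<alpha> \<Longrightarrow> T u z = (if cmod z < 1 then H z * u (lin_frac a b c d z) else 0)"
  shows "\<exists>C\<ge>0. \<forall>u\<in>A2 \<alpha>. T u \<in> A2 \<alpha> \<and> knorm2 (T u) \<le> C * knorm2 u"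
proof -
  obtain K where K: "0 < K" "\<And>f. f holomorphic_on unit_disk \<Longrightarrow>
     weighted_norm2 \<alpha> (\<lambda>z. H z * f (lin_frac a b c d z)) \<le> ennreal K * weighted_norm2 \<alpha> f"
    using weighted_norm2_weighted_comp_le[OF det self H, of \<alpha>] by blast
  note cd = lin_frac_self_map_coeffs[OF det self]
  have lf: "lin_frac a b c d holomorphic_on unit_disk"
    unfolding lin_frac_def[abs_def] by (intro holomorphic_intros) (use affine_nonzero[OF cd(1)] in auto)
  show ?thesis
  proof (rule bounded_on_A2)
    fix u assume u: "u \<in> A2 \<alpha>"
    have "(\<lambda>z. H z * u (lin_frac a b c d z)) holomorphic_on unit_disk"
      using holomorphic_on_compose_gen[OF lf A2_holomorphic[OF u] self]
      by (intro holomorphic_on_mult holomorphic_on_subset[OF H(1)]) (use H(2) in \<open>auto simp: o_def\<close>)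
    then show "T u holomorphic_on unit_disk"
      by (rule holomorphic_transform) (simp add: T[OF u])
    have "weighted_norm2 \<alpha> (T u) = weighted_norm2 \<alpha> (\<lambda>z. H z * u (lin_frac a b c d z))"
      by (rule weighted_norm2_cong) (simp add: T[OF u])
    then show "weighted_norm2 \<alpha> (T u) \<le> ennreal K * weighted_norm2 \<alpha> u"
      using K(2)[OF A2_holomorphic[OF u]] by simp
    show "T u z = 0" if "\<not> cmod z < 1" for z using that by (simp add: T[OF u])
  qed
qed

end

text \<open>Coinciding functions of the family contribute the sum of their coefficients.\<close>

lemma finite_rank_onI:
  assumes I: "finite I" and e: "\<And>i. i \<in> I \<Longrightarrow> e i \<in> V"
    and T: "\<And>f. f \<in> V \<Longrightarrow> \<exists>c. \<forall>z. T f z = (\<Sum>i\<in>I. c i * e i z)"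
  shows "finite_rank_on V T"
  unfolding finite_rank_on_def
proof (intro exI[of _ "e ` I"] conjI ballI)
  show "finite (e ` I)" "e ` I \<subseteq> V" using I e by auto
  fix f assume "f \<in> V"
  then obtain c where c: "\<And>z. T f z = (\<Sum>i\<in>I. c i * e i z)" using T by blast
  have "T f z = (\<Sum>x\<in>e ` I. (\<Sum>i\<in>{i\<in>I. e i = x}. c i) * x z)" for z
    unfolding c sum.image_gen[OF I, of _ e]
    by (intro sum.cong refl) (auto simp: sum_distrib_right)
  then have "T f = (\<lambda>z. \<Sum>x\<in>e ` I. (\<Sum>i\<in>{i\<in>I. e i = x}. c i) * x z)" by (rule ext)
  then show "\<exists>coef. T f = (\<lambda>z. \<Sum>x\<in>e ` I. coef x * x z)"
    by (rule exI[where x = "\<lambda>x. \<Sum>i\<in>{i\<in>I. e i = x}. c i"])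
qed

theorem theorem2p6:
  fixes \<alpha> :: real and N :: nat and Q :: "complex poly"
    and a b c d :: complex and g h \<phi> \<sigma> :: "complex \<Rightarrow> complex"
  assumes "\<alpha> + 2 \<notin> \<int>\<^sub>\<le>\<^sub>0"
    and "kernel_data \<alpha> N Q"
    and "a * d - b * c \<noteq> 0"
    and "\<phi> = lin_frac a b c d"
    and "\<phi> ` unit_disk \<subseteq> unit_disk"
    and "\<sigma> = krein_adjoint a b c d"
    and "power_branch (\<lambda>z. - cnj b * z + cnj d) (- \<alpha> - 2) g"
    and "power_branch (\<lambda>z. c * z + d) (\<alpha> + 2) h"
    and "g 0 * cnj (h 0) = 1"
  shows "finite_rank_on (A2 \<alpha>)
           (\<lambda>f z. A2_adjoint \<alpha> N Q (comp_op \<phi>) f z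
                  - mult_op g (comp_op \<sigma> (A2_adjoint \<alpha> N Q (mult_op h) f)) z)
         \<and> (\<alpha> + 2 > 0 \<longrightarrow>
              (\<forall>f\<in>A2 \<alpha>. A2_adjoint \<alpha> N Q (comp_op \<phi>) f
                  = mult_op g (comp_op \<sigma> (A2_adjoint \<alpha> N Q (mult_op h) f))))"
proof -
  interpret A2_space \<alpha> N Q using assms(1,2) by unfold_locales
  note \<phi> = assms(4) and \<sigma> = assms(6) and det = assms(3)
  have self: "lin_frac a b c d ` unit_disk \<subseteq> unit_disk" using assms(4,5) by simp
  note cd = lin_frac_self_map_coeffs[OF det self]
  define s where "s = complex_of_real (\<alpha> + 2)"
  \<comment> \<open>The hypotheses say nothing about g and h off the disk. \<open>G\<close> and
    \<open>H\<close> agree with them on the disk and are holomorphic past its closure, as the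
    boundedness lemma demands.\<close>
  define H where "H z = h 0 * exp (s * Ln (1 + (c / d) * z))" for z
  define G where "G z = g 0 * exp (- s * Ln (1 + (- cnj b / cnj d) * z))" for z
  have hH: "h z = H z" if "cmod z < 1" for z
    using power_branch_affine_eq[OF assms(8) cd(1) that] by (simp add: H_def s_def)
  have gG: "g z = G z" if "cmod z < 1" for z
    using power_branch_affine_eq[OF assms(7) _ that] cd(2) by (simp add: G_def s_def)
  have q1: "cmod (c / d) < 1" and q2: "cmod (- cnj b / cnj d) < 1"
    using cd by (auto simp: norm_divide divide_simps)
  obtain RH where RH: "1 < RH" "H holomorphic_on ball 0 RH"
    using exp_Ln_affine_extends[OF q1, of "h 0" s] unfolding H_def by blast
  obtain RG where RG: "1 < RG" "G holomorphic_on ball 0 RG"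
    using exp_Ln_affine_extends[OF q2, of "g 0" "- s"] unfolding G_def by blast
  have d0: "d \<noteq> 0" using cd by auto
  have \<sigma>_self: "cmod (\<sigma> w) < 1" if "cmod w < 1" for w
    unfolding \<sigma> using krein_adjoint_self_map[OF det self that] .
  have \<phi>_self: "cmod (\<phi> z) < 1" if "cmod z < 1" for z
    using assms(5) that by (auto simp: image_subset_iff)
  have \<sigma>_lf: "\<sigma> = lin_frac (cnj a) (- cnj c) (- cnj b) (cnj d)"
    by (auto simp: \<sigma> krein_adjoint_def lin_frac_def)
  have det\<sigma>: "cnj a * cnj d - (- cnj c) * (- cnj b) \<noteq> 0"
  proof -
    have "cnj a * cnj d - (- cnj c) * (- cnj b) = cnj (a * d - b * c)" by simp
    then show ?thesis using det by (metis complex_cnj_zero_iff)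
  qed

  \<comment> \<open>This is the power of the Krein identity. The factor d is split off both sides,
    so that only factors of the form 1 + q x with |q| < 1 and |x| < 1 enter the logarithms.\<close>
  have key: "(1 - \<phi> z * cnj w) powr (- s) = cnj (g w) * h z * (1 - z * cnj (\<sigma> w)) powr (- s)"
    if z: "cmod z < 1" and w: "cmod w < 1" for z w
  proof -
    define A where "A = 1 + (- cnj w) * \<phi> z"
    define B where "B = 1 + (c / d) * z"
    define C where "C = 1 + (- cnj b / cnj d) * w"
    define D where "D = 1 + (- cnj (\<sigma> w)) * z"
    have pos: "0 < Re A" "0 < Re B" "0 < Re C" "0 < Re D"
      unfolding A_def B_def C_def D_def
      by (rule Re_affine_pos; use z w \<phi>_self[OF z] \<sigma>_self[OF w] q1 q2 in simp)+
    then have posC: "0 < Re (cnj C)" by simp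
    have nz: "c * z + d \<noteq> 0" "- cnj b * w + cnj d \<noteq> 0"
      using affine_nonzero[OF cd(1), of z] affine_nonzero[of "- cnj b" "cnj d" w] cd z w by auto
    have "A * B * d = (1 - lin_frac a b c d z * cnj w) * (c * z + d)"
      using d0 by (simp add: A_def B_def \<phi> field_simps)
    also have "\<dots> = cnj C * D * d"
      unfolding krein_identity[OF nz] using d0 by (simp add: C_def D_def \<sigma> field_simps)
    finally have "A * B = cnj C * D" using d0 by simp
    then have ln: "Ln A + Ln B = Ln (cnj C) + Ln D"
      by (intro Ln_mult_eq_of_Re_pos pos posC)
    have lnC: "Ln (cnj C) = cnj (Ln C)"
      using pos(3) by (intro cnj_Ln[symmetric]) (auto simp: complex_nonpos_Reals_iff)
    have ne: "A \<noteq> 0" "D \<noteq> 0" using pos by auto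
    have "cnj (g w) * h z = (cnj (g 0) * h 0) * (exp (- s * cnj (Ln C)) * exp (s * Ln B))"
      by (simp add: hH[OF z] gG[OF w] H_def G_def B_def C_def s_def exp_cnj mult_ac)
    \<comment> \<open>Compatibility of the two branches enters here.\<close>
    also have "cnj (g 0) * h 0 = 1" using arg_cong[OF assms(9), of cnj] by simp
    finally have gh: "cnj (g w) * h z = exp (- s * cnj (Ln C) + s * Ln B)"
      by (simp only: mult_1 exp_add)
    have "(1 - \<phi> z * cnj w) powr (- s) = exp (- s * Ln A)"
      using ne by (simp add: powr_def A_def mult.commute)
    also have "Ln A = cnj (Ln C) + Ln D - Ln B" using ln lnC by (simp add: algebra_simps)
    also have "exp (- s * (cnj (Ln C) + Ln D - Ln B)) = exp (- s * cnj (Ln C) + s * Ln B) * exp (- s * Ln D)"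
      by (simp add: exp_add[symmetric] algebra_simps)
    also have "exp (- s * Ln D) = (1 - z * cnj (\<sigma> w)) powr (- s)"
      using ne by (simp add: powr_def D_def mult.commute)
    finally show ?thesis unfolding gh .
  qed

  have T1: "comp_op \<phi> u z = (if cmod z < 1 then 1 * u (lin_frac a b c d z) else 0)" for u z
    by (simp add: comp_op_def \<phi>)
  \<comment> \<open>Multiplication is a weighted composition with the identity map
    \<open>lin_frac 1 0 0 1\<close>. Off the disk the product vanishes because u does, whatever h is
    there.\<close>
  have T2: "mult_op h u z = (if cmod z < 1 then H z * u (lin_frac 1 0 0 1 z) else 0)" if "u \<in> A2 \<alpha>" for u z
    using A2_off[OF that] by (simp add: mult_op_def hH lin_frac_def)
  \<comment> \<open>Serves to place the spanning functions g \<sigma>^j in \<open>A2\<close>;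
    \<open>G\<close> replaces g, and the value off the disk is set to 0.\<close>
  define T3 where "T3 u z = (if cmod z < 1 then G z * u (\<sigma> z) else 0)" for u z
  obtain C1 where C1: "0 \<le> C1" "\<And>u. u \<in> A2 \<alpha> \<Longrightarrow> comp_op \<phi> u \<in> A2 \<alpha> \<and> knorm2 (comp_op \<phi> u) \<le> C1 * knorm2 u"
    using weighted_comp_in_A2[OF det self, of "\<lambda>_. 1" 2 "comp_op \<phi>"] T1 by auto
  obtain C2 where C2: "0 \<le> C2" "\<And>u. u \<in> A2 \<alpha> \<Longrightarrow> mult_op h u \<in> A2 \<alpha> \<and> knorm2 (mult_op h u) \<le> C2 * knorm2 u"
    using weighted_comp_in_A2[of 1 1 0 0 H RH "mult_op h"] T2 RH by (auto simp: lin_frac_def)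
  have T3: "T3 u \<in> A2 \<alpha>" if "u \<in> A2 \<alpha>" for u
  proof -
    have "T3 v z = (if cmod z < 1 then G z * v (lin_frac (cnj a) (- cnj c) (- cnj b) (cnj d) z) else 0)" for v z
      by (simp add: T3_def \<sigma>_lf)
    moreover have "lin_frac (cnj a) (- cnj c) (- cnj b) (cnj d) ` unit_disk \<subseteq> unit_disk"
      using \<sigma>_self by (auto simp: \<sigma>_lf)
    ultimately show ?thesis
      using weighted_comp_in_A2[OF det\<sigma> _ RG(2) RG(1), of T3] that by blast
  qed
  have lin1: "comp_op \<phi> (\<lambda>z. x * u z + y * v z) = (\<lambda>z. x * comp_op \<phi> u z + y * comp_op \<phi> v z)" for u v x y
    by (auto simp: comp_op_def)
  have lin2: "mult_op h (\<lambda>z. x * u z + y * v z) = (\<lambda>z. x * mult_op h u z + y * mult_op h v z)" for u v x y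
    by (auto simp: mult_op_def algebra_simps)

  define X where "X f = A2_adjoint \<alpha> N Q (comp_op \<phi>) f" for f
  define Y where "Y f = mult_op g (comp_op \<sigma> (A2_adjoint \<alpha> N Q (mult_op h) f))" for f
  define J where "J = {..degree Q}"
  have fin: "finite J" by (simp add: J_def)
  have X_off: "X f z = 0" if "f \<in> A2 \<alpha>" "\<not> cmod z < 1" for f z
    unfolding X_def by (rule A2_off[OF A2_adjoint_in_A2[OF C1 lin1 that(1)] that(2)])
  have Y_off: "Y f z = 0" if "\<not> cmod z < 1" for f z
    using that by (simp add: Y_def mult_op_def comp_op_def[of \<sigma>])
  have diff: "X f w - Y f w = (\<Sum>j\<in>J. cnj (coeff Q j * ip (comp_op \<phi> (disk_monom j)) f) * w ^ j)
        + (\<Sum>j\<in>J. (- cnj (coeff Q j * ip (mult_op h (disk_monom j)) f)) * (g w * \<sigma> w ^ j))"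
    if f: "f \<in> A2 \<alpha>" and w: "cmod w < 1" for f w
  proof -
    define A where "A = comp_op \<phi> (rep_kernel w)"
    define B where "B = mult_op h (rep_kernel (\<sigma> w))"
    define E1 where "E1 j = comp_op \<phi> (disk_monom j)" for j
    define E2 where "E2 j = mult_op h (disk_monom j)" for j
    have AB: "A \<in> A2 \<alpha>" "B \<in> A2 \<alpha>"
      unfolding A_def B_def using C1 C2 rep_kernel_in_A2 w \<sigma>_self[OF w] by auto
    have E: "E1 j \<in> A2 \<alpha>" "E2 j \<in> A2 \<alpha>" for j
      unfolding E1_def E2_def using C1 C2 disk_monom_in_A2 by auto
    \<comment> \<open>\<open>S1\<close> and \<open>S2\<close> are the parts of the two kernels that
      come from \<open>Q\<close>. They combine the functions \<open>E1 j\<close>,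
      \<open>E2 j\<close>, which are free of w, with coefficients depending on w. Pairing with f and
      conjugating turns these coefficients into w^j and \<sigma>(w)^j.\<close>
    define S1 where "S1 = (\<lambda>z. \<Sum>j\<in>J. (coeff Q j * cnj w ^ j) * E1 j z)"
    define S2 where "S2 = (\<lambda>z. \<Sum>j\<in>J. (coeff Q j * cnj (\<sigma> w) ^ j) * E2 j z)"
    have S: "S1 \<in> A2 \<alpha>" "S2 \<in> A2 \<alpha>"
      "ip S1 f = (\<Sum>j\<in>J. (coeff Q j * cnj w ^ j) * ip (E1 j) f)"
      "ip S2 f = (\<Sum>j\<in>J. (coeff Q j * cnj (\<sigma> w) ^ j) * ip (E2 j) f)"
      unfolding S1_def S2_def using A2_sum[OF fin, of _ f] E f by auto
    \<comment> \<open>By \<open>key\<close> the powers in \<open>A\<close> and in conj(g(w))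
      \<open>B\<close> are equal and drop out.\<close>
    have "(\<lambda>z. 1 * A z + (- cnj (g w)) * B z) = (\<lambda>z. 1 * S1 z + (- cnj (g w)) * S2 z)"
    proof
      fix z
      show "1 * A z + (- cnj (g w)) * B z = 1 * S1 z + (- cnj (g w)) * S2 z"
      proof (cases "cmod z < 1")
        case True
        have s': "complex_of_real \<alpha> + 2 = s" by (simp add: s_def)
        have "A z = (-1) ^ N * (1 - \<phi> z * cnj w) powr (- s) + poly Q (\<phi> z * cnj w)"
          using True by (simp add: A_def comp_op_def rep_kernel_eq[OF w \<phi>_self[OF True]] kernel_profile_def s')
        moreover have "B z = h z * ((-1) ^ N * (1 - z * cnj (\<sigma> w)) powr (- s) + poly Q (z * cnj (\<sigma> w)))"
          using True by (simp add: B_def mult_op_def rep_kernel_eq[OF \<sigma>_self[OF w] True] kernel_profile_def s')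
        ultimately have "1 * A z + (- cnj (g w)) * B z = poly Q (\<phi> z * cnj w) - cnj (g w) * h z * poly Q (z * cnj (\<sigma> w))"
          unfolding key[OF True w] by (simp add: algebra_simps)
        moreover have "S1 z = poly Q (\<phi> z * cnj w)"
          using True \<phi>_self[OF True] unfolding S1_def poly_altdef J_def
          by (intro sum.cong) (auto simp: E1_def comp_op_def disk_monom_eq power_mult_distrib)
        moreover have "S2 z = h z * poly Q (z * cnj (\<sigma> w))"
          using True unfolding S2_def poly_altdef J_def sum_distrib_left
          by (intro sum.cong) (auto simp: E2_def mult_op_def disk_monom_eq power_mult_distrib)
        ultimately show ?thesis by (simp add: mult.assoc)
      next
        case False
        then show ?thesis
          using A2_off[OF AB(1)] A2_off[OF AB(2)] A2_off[OF S(1)] A2_off[OF S(2)] by simp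
      qed
    qed
    then have "ip A f - cnj (g w) * ip B f = ip S1 f - cnj (g w) * ip S2 f"
      using ip_lincomb[OF AB f, of 1 "- cnj (g w)"] ip_lincomb[OF S(1,2) f, of 1 "- cnj (g w)"] by simp
    moreover have "X f w = cnj (ip A f)"
      unfolding X_def A_def by (rule A2_adjoint_eval[OF C1 lin1 f w])
    moreover have "Y f w = g w * cnj (ip B f)"
      using w A2_adjoint_eval[OF C2 lin2 f \<sigma>_self[OF w]]
      by (simp add: Y_def B_def mult_op_def[of g] comp_op_def[of \<sigma>])
    ultimately have "X f w - Y f w = cnj (ip S1 f - cnj (g w) * ip S2 f)"
      by (metis complex_cnj_cnj complex_cnj_diff complex_cnj_mult)
    then show ?thesis
      unfolding S by (simp add: E1_def E2_def sum_distrib_left sum_negf mult_ac)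
  qed

  \<comment> \<open>The disjoint sum of index sets lists w^j and g(w) \<sigma>(w)^j separately even
    if some of these functions coincide.\<close>
  define e where "e = case_sum disk_monom (\<lambda>j. T3 (disk_monom j))"
  have "finite_rank_on (A2 \<alpha>) (\<lambda>f z. X f z - Y f z)"
  proof (rule finite_rank_onI[where I = "J <+> J" and e = e])
    show "finite (J <+> J)" using fin by simp
    show "e i \<in> A2 \<alpha>" for i
      by (cases i) (auto simp: e_def disk_monom_in_A2 T3)
    fix f assume f: "f \<in> A2 \<alpha>"
    define k where "k = case_sum (\<lambda>j. cnj (coeff Q j * ip (comp_op \<phi> (disk_monom j)) f)) (\<lambda>j. - cnj (coeff Q j * ip (mult_op h (disk_monom j)) f))"
    have "X f z - Y f z = (\<Sum>i\<in>J <+> J. k i * e i z)" for z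
    proof (cases "cmod z < 1")
      case True
      then show ?thesis
        unfolding sum.Plus[OF fin fin] diff[OF f True]
        by (simp add: k_def e_def T3_def disk_monom_eq \<sigma>_self gG)
    next
      case False
      then show ?thesis
        unfolding sum.Plus[OF fin fin] using f by (simp add: k_def e_def T3_def disk_monom_eq X_off Y_off)
    qed
    then show "\<exists>c. \<forall>z. X f z - Y f z = (\<Sum>i\<in>J <+> J. c i * e i z)" by blast
  qed
  moreover have "X f = Y f" if "\<alpha> + 2 > 0" "f \<in> A2 \<alpha>" for f
  proof
    fix w
    \<comment> \<open>With \<open>Q = 0\<close> every coefficient in \<open>diff\<close> is zero, so
      the two operators agree on the disk; both sides vanish off it.\<close>
    have "Q = 0" using data that(1) by (auto simp: kernel_data_def)
    then show "X f w = Y f w"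
      using diff[OF that(2), of w] X_off[OF that(2), of w] Y_off[of w f] by (cases "cmod w < 1") auto
  qed
  ultimately show ?thesis unfolding X_def Y_def by blast
qed

end
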